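(* Fix integers $N\ge 2$ and $m>N$. With the notation $\mathcal A(m,N)$, $r_x$, $M_N(m)$, $c_{N,m}$, $V_n(N,m)$, $W_N$, $D_N(w)$ defined in the context, the following hold. (i) (Resultant formula) Let $Q(u):=u^m-1$. Then, as an identity of rational functions in $w$, $$D_N(w)^{(N-1)!}=(f(w))^{-1}\operatorname{Res}_{u_1}\Big(Q(u_1),\operatorname{Res}_{u_2}\big(Q(u_2),\dots,\operatorname{Res}_{u_{N-1}}(Q(u_{N-1}),W_N(u_1,\dots,u_{N-1};w))\dots\big)\Big),$$ where $f(w)=\varepsilon_{N,m}\,w^{\,m^{N-1}-M_N(m)\,(N-1)!}$, with $\varepsilon_{N,m}=1$ for $N\ge 3$ and every $m$, and $\varepsilon_{2,m}=(-1)^{m-1}$. In particular $D_N(w)$ is an $(N-1)!$-th root of the right-hand side. (ii) (Generating function) Set $V_0(N,m):=2M_N(m)$ and $G_N(w):=D_N'(w)/D_N(w)$. Then $$\sum_{n\ge 0}V_n(N,m)\,\tau^n = 2\big(M_N(m)-v\,G_N(v)\big)\Big|_{v=c_{N,m}\tau}$$ as an identity of formal power series in $\tau$. Analytically, both sides agree and the series on the left converges uniformly and absolutely for $|\tau|\le R$, for any $R<\min_{x\in\mathcal A(m,N)} r_x/c_{N,m}$. (iii) (Linear recursion for fixed $m$ and $N$) Write $D_N(c_{N,m}\tau)=\sum_k q_k\tau^k$ and let $p_n$ be the $n$-th coefficient of $$P_N(\tau):=2\big(M_N(m)D_N(c_{N,m}\tau)-c_{N,m}\tau\, D_N'(c_{N,m}\tau)\big).$$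 Then, with $V_0(N,m)=2M_N(m)$, the sequence $(V_n(N,m))_{n\ge 0}$ satisfies the linear recursion with constant coefficients, of order at most $M_N(m)$, $$\sum_{k=0}^{\min(n,M_N(m))}q_k\,V_{n-k}(N,m)=\begin{cases}p_n, & 0\le n\le M_N(m),\\ 0,& n>M_N(m).\end{cases}$$ (iv) (Binet formula) Let $a$ range over the distinct values among $\{r_x\}_{x\in\mathcal A(m,N)}$, let $\mu(a)$ be the cardinality of $\{x\in\mathcal A(m,N): r_x=a\}$, and set $y_a:=c_{N,m}/a$. Then for every $n\ge 1$, $$V_n(N,m)=2\sum_a \mu(a)\,y_a^{\,n}.$$
   Context: For integers $m>N\ge 2$ put $$\mathcal A(m,N):=\{x=(x_1,\dots,x_{N-1})\in\mathbb Z^{N-1}: 0<x_1<\cdots<x_{N-1}<m\},$$ with the convention $x_0:=0$; its cardinality is $M_N(m):=\binom{m-1}{N-1}$. Set $c_{N,m}:=Nm^{N-1}$. For $x\in\mathcal A(m,N)$ put $$r_x:=\prod_{0\le a<b\le N-1}4\sin^2\frac{\pi(x_b-x_a)}{m}.$$ The Verlinde sums are, for $n\ge 1$, $$V_n(N,m):=2\,(Nm^{N-1})^n\sum_{0<x_1<\cdots<x_{N-1}<m}\ \prod_{0\le a<b\le N-1}\Big(2\sin\frac{\pi(x_b-x_a)}{m}\Big)^{-2n}.$$ Define $D_N(w):=\prod_{x\in\mathcal A(m,N)}(w-r_x)$ (this depends on $m$ too); $D_N'$ is its derivative in $w$, and $D_N'(c_{N,m}\tau)$ means $D_N'$ evaluated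 at $c_{N,m}\tau$. For $u=(u_0,\dots,u_{N-1})$ let $\Delta(u):=\prod_{0\le a<b\le N-1}(u_a-u_b)$. Define $$W_N(u_1,\dots,u_{N-1};w):=w\prod_{a=1}^{N-1}u_a^{N-1}-(-1)^{\binom N2}\Delta(1,u_1,\dots,u_{N-1})^2.$$ $\operatorname{Res}_{u}(f,g)$ denotes the resultant with respect to the variable $u$, i.e. the determinant of the Sylvester matrix of $f$ and $g$ (rows of shifted coefficients, highest degree first, of $f$ first and then of $g$), viewed as polynomials in $u$ with coefficients in the polynomial ring in the remaining variables. *)

theory Defs
  imports
    "Subresultants.Resultant_Prelim"
    "HOL-Library.Poly_Mapping"
    "HOL-Analysis.Analysis"
    "HOL-Computational_Algebra.Computational_Algebra"
begin

section \<open>Verlinde sums\<close>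

text \<open>A point \<open>(x\<^sub>1, \<dots>, x\<^sub>N\<^sub>-\<^sub>1)\<close> is a list of length \<open>N - 1\<close>. With the convention \<open>x\<^sub>0 = 0\<close>,
  the coordinate \<open>x\<^sub>a\<close> is \<open>(0 # xs) ! a\<close> for \<open>0 \<le> a \<le> N - 1\<close>.\<close>

definition alcove :: "nat \<Rightarrow> nat \<Rightarrow> int list set" where
  "alcove N m = {xs. length xs = N - 1 \<and> sorted_wrt (<) (0 # xs) \<and> (\<forall>x\<in>set xs. x < int m)}"

definition alcove_count :: "nat \<Rightarrow> nat \<Rightarrow> nat" where
  "alcove_count N m = (m - 1) choose (N - 1)"

definition cconst :: "nat \<Rightarrow> nat \<Rightarrow> real" where
  "cconst N m = real N * real m ^ (N - 1)"

definition sin_diff :: "nat \<Rightarrow> int list \<Rightarrow> nat \<Rightarrow> nat \<Rightarrow> real" where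
  "sin_diff m xs a b = sin (pi * real_of_int ((0 # xs) ! b - (0 # xs) ! a) / real m)"

definition rval :: "nat \<Rightarrow> nat \<Rightarrow> int list \<Rightarrow> real" where
  "rval N m xs = (\<Prod>b<N. \<Prod>a<b. 4 * (sin_diff m xs a b)\<^sup>2)"

definition verlinde_sum :: "nat \<Rightarrow> nat \<Rightarrow> nat \<Rightarrow> real" where
  "verlinde_sum N m n = 2 * (real N * real m ^ (N - 1)) ^ n *
     (\<Sum>xs\<in>alcove N m. \<Prod>b<N. \<Prod>a<b. (2 * sin_diff m xs a b) powi (- 2 * int n))"

definition verlinde :: "nat \<Rightarrow> nat \<Rightarrow> nat \<Rightarrow> real" where
  "verlinde N m n = (if n = 0 then 2 * real (alcove_count N m) else verlinde_sum N m n)"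

definition D_poly :: "nat \<Rightarrow> nat \<Rightarrow> real poly" where
  "D_poly N m = (\<Prod>xs\<in>alcove N m. [:- rval N m xs, 1:])"

text \<open>The logarithmic derivative \<open>G\<^sub>N = D\<^sub>N' / D\<^sub>N\<close>, once expanded as a formal power series at \<open>0\<close>
  (the constant coefficient of \<open>D\<^sub>N\<close> is nonzero) and once as a function on the complex plane.\<close>

definition G_fps :: "nat \<Rightarrow> nat \<Rightarrow> real fps" where
  "G_fps N m = fps_of_poly (pderiv (D_poly N m)) / fps_of_poly (D_poly N m)"

definition D_fun :: "nat \<Rightarrow> nat \<Rightarrow> complex \<Rightarrow> complex" where
  "D_fun N m z = poly (map_poly complex_of_real (D_poly N m)) z"

definition G_fun :: "nat \<Rightarrow> nat \<Rightarrow> complex \<Rightarrow> complex" where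
  "G_fun N m z = deriv (D_fun N m) z / D_fun N m z"

definition D_scaled :: "nat \<Rightarrow> nat \<Rightarrow> real poly" where
  "D_scaled N m = D_poly N m \<circ>\<^sub>p [:0, cconst N m:]"

definition P_poly :: "nat \<Rightarrow> nat \<Rightarrow> real poly" where
  "P_poly N m = 2 * (of_nat (alcove_count N m) * D_scaled N m
     - [:0, cconst N m:] * (pderiv (D_poly N m) \<circ>\<^sub>p [:0, cconst N m:]))"

section \<open>The iterated resultant\<close>

text \<open>Polynomials in \<open>w\<close> and \<open>u\<^sub>1, u\<^sub>2, \<dots>\<close>: finitely supported maps from monomials in the \<open>u\<^sub>i\<close>
  to coefficients in \<open>\<real>[w]\<close>.\<close>

type_synonym wu_poly = "(nat \<Rightarrow>\<^sub>0 nat) \<Rightarrow>\<^sub>0 real poly"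

definition const_w :: "real poly \<Rightarrow> wu_poly" where
  "const_w p = Poly_Mapping.single 0 p"

definition var_u :: "nat \<Rightarrow> wu_poly" where
  "var_u k = Poly_Mapping.single (Poly_Mapping.single k 1) 1"

text \<open>\<open>as_poly_in k p\<close> is \<open>p\<close> as a univariate polynomial in \<open>u\<^sub>k\<close> whose coefficients are
  polynomials in the remaining variables.\<close>

definition as_poly_in :: "nat \<Rightarrow> wu_poly \<Rightarrow> wu_poly poly" where
  "as_poly_in k p = (\<Sum>\<mu>\<in>Poly_Mapping.keys p.
     monom (Poly_Mapping.single (Poly_Mapping.update k 0 \<mu>) (Poly_Mapping.lookup p \<mu>))
       (Poly_Mapping.lookup \<mu> k))"

lemma poly_as_poly_in: "poly (as_poly_in k p) (var_u k) = p"
proof -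
  have pow: "var_u k ^ n = Poly_Mapping.single (Poly_Mapping.single k n) 1" for n
    by (induction n) (simp_all add: var_u_def mult_single single_add[symmetric])
  have upd: "Poly_Mapping.update k 0 \<mu> + Poly_Mapping.single k (Poly_Mapping.lookup \<mu> k) = \<mu>"
    for \<mu> :: "nat \<Rightarrow>\<^sub>0 nat"
    by (rule poly_mapping_eqI)
      (auto simp: lookup_add lookup_update lookup_single when_def)
  have "poly (as_poly_in k p) (var_u k)
      = (\<Sum>\<mu>\<in>Poly_Mapping.keys p. Poly_Mapping.single \<mu> (Poly_Mapping.lookup p \<mu>))"
    by (simp add: as_poly_in_def poly_sum poly_monom pow mult_single upd)
  also have "\<dots> = p"
    by (rule poly_mapping_eqI)
      (auto simp: lookup_sum lookup_single when_def in_keys_iff sum.delta)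
  finally show ?thesis .
qed

lemma coeff_as_poly_in_free:
  assumes "\<mu> \<in> Poly_Mapping.keys (coeff (as_poly_in k p) i)"
  shows "Poly_Mapping.lookup \<mu> k = 0"
proof (rule ccontr)
  assume "Poly_Mapping.lookup \<mu> k \<noteq> 0"
  hence "Poly_Mapping.update k 0 \<nu> \<noteq> \<mu>" for \<nu>
    by (metis lookup_update)
  hence "Poly_Mapping.lookup (coeff (as_poly_in k p) i) \<mu> = 0"
    by (simp add: as_poly_in_def coeff_sum coeff_monom lookup_sum lookup_single when_def
        sum.neutral)
  with assms show False by (simp add: in_keys_iff)
qed

definition resultant_in :: "nat \<Rightarrow> wu_poly \<Rightarrow> wu_poly \<Rightarrow> wu_poly" where
  "resultant_in k f g = resultant (as_poly_in k f) (as_poly_in k g)"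

definition Q_poly :: "nat \<Rightarrow> nat \<Rightarrow> wu_poly" where
  "Q_poly m k = var_u k ^ m - 1"

definition Vandermonde :: "nat \<Rightarrow> (nat \<Rightarrow> wu_poly) \<Rightarrow> wu_poly" where
  "Vandermonde N u = (\<Prod>b<N. \<Prod>a<b. u a - u b)"

definition W_poly :: "nat \<Rightarrow> wu_poly" where
  "W_poly N = const_w [:0, 1:] * (\<Prod>a\<in>{1..N - 1}. var_u a ^ (N - 1))
     - (- 1) ^ (N choose 2) * Vandermonde N (\<lambda>a. if a = 0 then 1 else var_u a) ^ 2"

text \<open>\<open>iterated_resultant m k g\<close> is
  \<open>Res\<^sub>u\<^sub>1 (Q(u\<^sub>1), Res\<^sub>u\<^sub>2 (Q(u\<^sub>2), \<dots>, Res\<^sub>u\<^sub>k (Q(u\<^sub>k), g) \<dots>))\<close>.\<close>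

primrec iterated_resultant :: "nat \<Rightarrow> nat \<Rightarrow> wu_poly \<Rightarrow> wu_poly" where
  "iterated_resultant m 0 g = g"
| "iterated_resultant m (Suc k) g =
     iterated_resultant m k (resultant_in (Suc k) (Q_poly m (Suc k)) g)"

definition eps :: "nat \<Rightarrow> nat \<Rightarrow> real" where
  "eps N m = (if N = 2 then (- 1) ^ (m - 1) else 1)"

definition f_poly :: "nat \<Rightarrow> nat \<Rightarrow> real poly" where
  "f_poly N m = monom (eps N m) (m ^ (N - 1) - alcove_count N m * fact (N - 1))"

lemma f_poly_exponent_nonneg: "alcove_count N m * fact (N - 1) \<le> m ^ (N - 1)"
proof -
  have "alcove_count N m * fact (N - 1) \<le> (m - 1) ^ (N - 1)"
    unfolding alcove_count_def by (rule binomial_fact_pow)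
  also have "\<dots> \<le> m ^ (N - 1)"
    by (rule power_mono) auto
  finally show ?thesis .
qed

end

(*
  At a point of m-th roots of unity u_a = exp(2 pi i x_a / m), the identity
  (u_a - u_b)^2 = - u_a u_b 4 sin^2(pi (x_b - x_a) / m) turns W_N into a unit times w - r_x.
  The resultant with the monic split polynomial u^m - 1 is the product of the values at its
  roots, so the iterated resultant is the product of W_N over all tuples of m-th roots of
  unity. Tuples with a repeated entry, or an entry equal to u_0 = 1, have r_x = 0 and
  contribute powers of w; the others are the (N-1)! permutations of the points of the alcove.
  The remaining parts rest on V_n = 2 sum_x (c / r_x)^n: a geometric series for each x, with
  2 D_N(c tau) as a common denominator.
*)
theory Submission
  imports Defs "HOL-Combinatorics.Multiset_Permutations"
begin

section \<open>Resultants with split monic polynomials\<close>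

text \<open>The roots of unity do not lie in the ring of the \<open>wu_poly\<close>s, so each
  resultant is carried to the complex numbers by an evaluation homomorphism and computed there.
  Values at points do not by themselves show that the iterated resultant is free of the u's; this is
  established separately, by following which variables can occur in coefficients and determinants.
  Only then does agreement at all real w yield an identity of real polynomials. The unit split off
  from W_N is a power of the product of the chosen roots, and over all tuples these units multiply
  to a sign. The product of all m-th roots of unity is (-1)^(m-1); it survives for N = 2, whereas
  for N >= 3 it enters only through even powers whenever it equals -1.\<close>

lemma poly_eq_sum_le:
  fixes p :: "'a::comm_semiring_1 poly"
  assumes "degree p \<le> n"
  shows "poly p x = (\<Sum>l\<le>n. coeff p l * x ^ l)"
  unfolding poly_altdef
  by (rule sum.mono_neutral_left) (use assms in \<open>auto simp: coeff_eq_0\<close>)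

text \<open>A kernel vector of the transpose is the coefficient vector of a polynomial of degree
  below m with m distinct roots. Nonvanishing is all that is required, since the determinant is only
  cancelled later.\<close>

lemma det_Vandermonde_nonzero:
  fixes a :: "nat \<Rightarrow> 'a::field"
  assumes inj: "inj_on a {..<m}"
  shows "Determinant.det (Matrix.mat m m (\<lambda>(i, j). a j ^ (m - 1 - i))) \<noteq> 0"
proof
  let ?V = "Matrix.mat m m (\<lambda>(i, j). a j ^ (m - 1 - i))"
  assume "Determinant.det ?V = 0"
  hence "Determinant.det (transpose_mat ?V) = 0"
    by (subst Determinant.det_transpose[of _ m]) auto
  then obtain v where v: "v \<in> carrier_vec m" "v \<noteq> 0\<^sub>v m"
    and zero: "transpose_mat ?V *\<^sub>v v = 0\<^sub>v m"
    by (subst (asm) det_0_iff_vec_prod_zero_field[of _ m]) auto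
  define q where "q = (\<Sum>i<m. monom (vec_index v i) (m - 1 - i))"
  have root: "poly q (a j) = 0" if "j < m" for j
  proof -
    have "0 = vec_index (transpose_mat ?V *\<^sub>v v) j" using zero that by simp
    also have "\<dots> = (\<Sum>i<m. a j ^ (m - 1 - i) * vec_index v i)"
      using that v by (auto simp: scalar_prod_def atLeast0LessThan intro!: sum.cong)
    finally show ?thesis by (simp add: q_def poly_sum poly_monom mult.commute)
  qed
  have coeff_q: "coeff q (m - 1 - i) = vec_index v i" if "i < m" for i
  proof -
    have "coeff q (m - 1 - i) = (\<Sum>k<m. if k = i then vec_index v k else 0)"
      unfolding q_def coeff_sum using that by (intro sum.cong) auto
    thus ?thesis using that by simp
  qed
  have "q = 0"
  proof (rule ccontr)
    assume "q \<noteq> 0"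
    hence m: "m > 0" by (auto simp: q_def intro: ccontr)
    have "m = card (a ` {..<m})" using inj by (simp add: card_image)
    also have "\<dots> \<le> card {x. poly q x = 0}"
      using root \<open>q \<noteq> 0\<close> by (intro card_mono poly_roots_finite) auto
    also have "\<dots> \<le> degree q" by (rule card_poly_roots_bound[OF \<open>q \<noteq> 0\<close>])
    also have "degree q \<le> m - 1"
      unfolding q_def by (rule degree_sum_le) (auto intro: order.trans[OF degree_monom_le])
    finally show False using m by simp
  qed
  hence "v = 0\<^sub>v m" using coeff_q v by (intro eq_vecI) auto
  with v show False by simp
qed

text \<open>Each row lists the coefficients of a shift of \<open>f\<close> or \<open>g\<close>,
  highest degree first, so pairing it with the powers of x evaluates that shift. The numbers
  \<open>m\<close> and \<open>n\<close> are only upper bounds for the degrees, which leaves room for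
  a degree drop under specialization.\<close>

lemma Sylvester_row_eval:
  fixes f g :: "'a::comm_ring_1 poly"
  assumes "degree f \<le> m" "degree g \<le> n" "i < m + n"
  shows "(\<Sum>k<m + n. sylvester_mat_sub m n f g $$ (i, k) * x ^ (m + n - 1 - k))
    = (if i < n then x ^ (n - 1 - i) * poly f x else x ^ (m + n - 1 - i) * poly g x)"
proof (cases "i < n")
  case True
  have "(\<Sum>k<m + n. sylvester_mat_sub m n f g $$ (i, k) * x ^ (m + n - 1 - k))
      = (\<Sum>k<m + n. if k \<in> {i..i + m} then coeff f (m + i - k) * x ^ (m + n - 1 - k) else 0)"
    by (intro sum.cong) (use True in \<open>auto simp: sylvester_mat_sub_index\<close>)
  also have "\<dots> = (\<Sum>k\<in>{i..i + m}. coeff f (m + i - k) * x ^ (m + n - 1 - k))"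
    by (subst sum.inter_restrict[symmetric]) (use True in \<open>auto intro: sum.cong\<close>)
  also have "\<dots> = (\<Sum>l\<le>m. coeff f l * x ^ (n - 1 - i + l))"
    by (rule sum.reindex_bij_witness[of _ "\<lambda>l. i + m - l" "\<lambda>k. m + i - k"])
      (use True in \<open>auto intro!: arg_cong[of _ _ "\<lambda>t. _ * x ^ t"]\<close>)
  also have "\<dots> = x ^ (n - 1 - i) * poly f x"
    unfolding poly_eq_sum_le[OF assms(1)] sum_distrib_left
    by (intro sum.cong) (auto simp: power_add mult_ac)
  finally show ?thesis using True by simp
next
  case False
  have "(\<Sum>k<m + n. sylvester_mat_sub m n f g $$ (i, k) * x ^ (m + n - 1 - k))
      = (\<Sum>k<m + n. if k \<in> {i - n..i} then coeff g (i - k) * x ^ (m + n - 1 - k) else 0)"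
    by (intro sum.cong) (use False assms(3) in \<open>auto simp: sylvester_mat_sub_index\<close>)
  also have "\<dots> = (\<Sum>k\<in>{i - n..i}. coeff g (i - k) * x ^ (m + n - 1 - k))"
    by (subst sum.inter_restrict[symmetric]) (use False assms(3) in \<open>auto intro: sum.cong\<close>)
  also have "\<dots> = (\<Sum>l\<le>n. coeff g l * x ^ (m + n - 1 - i + l))"
    by (rule sum.reindex_bij_witness[of _ "\<lambda>l. i - l" "\<lambda>k. i - k"])
      (use False assms(3) in \<open>auto intro!: arg_cong[of _ _ "\<lambda>t. _ * x ^ t"]\<close>)
  also have "\<dots> = x ^ (m + n - 1 - i) * poly g x"
    unfolding poly_eq_sum_le[OF assms(2)] sum_distrib_left
    by (intro sum.cong) (auto simp: power_add mult_ac)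
  finally show ?thesis using False by simp
qed

text \<open>Multiplying the Sylvester matrix by a unit block followed by the columns of powers of the
  roots makes it block triangular: the rows of \<open>f\<close> vanish on the new columns, and the rows of \<open>g\<close>
  become a Vandermonde matrix with columns scaled by the values of \<open>g\<close>.\<close>

lemma det_Sylvester_split_monic:
  fixes f g :: "'a::field poly"
  assumes f: "degree f \<le> m" "coeff f m = 1" and g: "degree g \<le> n"
    and inj: "inj_on a {..<m}" and roots: "\<And>i. i < m \<Longrightarrow> poly f (a i) = 0"
  shows "Determinant.det (sylvester_mat_sub m n f g) = (\<Prod>i<m. poly g (a i))"
proof -
  let ?S = "sylvester_mat_sub m n f g"
  define V where "V = Matrix.mat m m (\<lambda>(i, j). a j ^ (m - 1 - i))"
  define B where "B = Matrix.mat n m (\<lambda>(i, j). a j ^ (m + n - 1 - i))"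
  define T where "T = Matrix.mat n n (\<lambda>(i, j). ?S $$ (i, j))"
  define C where "C = Matrix.mat m n (\<lambda>(i, j). ?S $$ (i + n, j))"
  define G where "G = mat_diag m (\<lambda>j. poly g (a j))"
  define W where "W = four_block_mat (1\<^sub>m n) B (0\<^sub>m m n) V"
  have V: "V \<in> carrier_mat m m" and B: "B \<in> carrier_mat n m" and T: "T \<in> carrier_mat n n"
    and C: "C \<in> carrier_mat m n" and G: "G \<in> carrier_mat m m"
    by (simp_all add: V_def B_def T_def C_def G_def)
  have W: "W \<in> carrier_mat (m + n) (m + n)"
    unfolding W_def using four_block_carrier_mat[OF one_carrier_mat V, of n] by (simp add: add.commute)
  have W_col: "W $$ (k, j) = (if k = j then 1 else 0)" if "j < n" "k < m + n" for k j
    using that V by (auto simp: W_def)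
  have W_col': "W $$ (k, j) = a (j - n) ^ (m + n - 1 - k)"
    if "n \<le> j" "j < m + n" "k < m + n" for k j
    using that V by (auto simp: W_def V_def B_def)
  have VG: "(V * G) $$ (i, j) = a j ^ (m - 1 - i) * poly g (a j)" if "i < m" "j < m" for i j
    using that by (simp add: G_def V_def mat_diag_mult_right[of _ m])
  have "?S * W = four_block_mat T (0\<^sub>m n m) C (V * G)"
  proof (rule eq_matI)
    fix i j assume "i < dim_row (four_block_mat T (0\<^sub>m n m) C (V * G))"
      "j < dim_col (four_block_mat T (0\<^sub>m n m) C (V * G))"
    hence ij: "i < m + n" "j < m + n" using T V G by auto
    have prod: "(?S * W) $$ (i, j) = (\<Sum>k<m + n. ?S $$ (i, k) * W $$ (k, j))"
      using ij W by (auto simp: scalar_prod_def atLeast0LessThan intro!: sum.cong)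
    show "(?S * W) $$ (i, j) = four_block_mat T (0\<^sub>m n m) C (V * G) $$ (i, j)"
    proof (cases "j < n")
      case True
      have "(?S * W) $$ (i, j) = (\<Sum>k<m + n. if k = j then ?S $$ (i, k) else 0)"
        unfolding prod using True W_col by (intro sum.cong) auto
      also have "\<dots> = ?S $$ (i, j)" using ij by simp
      finally show ?thesis using True ij T V G by (auto simp: T_def C_def)
    next
      case False
      have "(?S * W) $$ (i, j)
          = (\<Sum>k<m + n. ?S $$ (i, k) * a (j - n) ^ (m + n - 1 - k))"
        unfolding prod using False ij W_col' by (intro sum.cong) auto
      also have "\<dots> = (if i < n then 0 else a (j - n) ^ (m + n - 1 - i) * poly g (a (j - n)))"
        using Sylvester_row_eval[OF f(1) g ij(1), of "a (j - n)"] roots[of "j - n"] False ij by auto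
      also have "\<dots> = four_block_mat T (0\<^sub>m n m) C (V * G) $$ (i, j)"
        using False ij T V G VG[of "i - n" "j - n"] by (auto simp: add.commute)
      finally show ?thesis .
    qed
  qed (use T V G W in auto)
  hence "Determinant.det ?S * Determinant.det W = Determinant.det T * Determinant.det (V * G)"
    using Determinant.det_mult[OF sylvester_mat_sub_carrier[of m n f g] W]
      det_four_block_mat_upper_right_zero[OF T refl C mult_carrier_mat[OF V G]]
    by simp
  moreover have "Determinant.det W = Determinant.det V"
    unfolding W_def by (subst det_four_block_mat_lower_left_zero[OF one_carrier_mat B refl V]) simp
  moreover have "Determinant.det T = 1"
  proof -
    \<comment> \<open>Left of the diagonal the shifted rows of \<open>f\<close> have not started
      yet, and on the diagonal stands the coefficient of \<open>f\<close> at \<open>m\<close>. This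
      is where monicity enters.\<close>
    have "upper_triangular T" by (auto simp: T_def sylvester_mat_sub_index)
    hence "Determinant.det T = prod_list (diag_mat T)" using T by (rule Determinant.det_upper_triangular)
    also have "\<dots> = (\<Prod>i<n. T $$ (i, i))" using T
      by (simp add: prod_list_diag_prod atLeast0LessThan)
    also have "\<dots> = 1" using f(2) by (intro prod.neutral) (auto simp: T_def sylvester_mat_sub_index)
    finally show ?thesis .
  qed
  moreover have "Determinant.det (V * G) = Determinant.det V * (\<Prod>i<m. poly g (a i))"
  proof -
    have "upper_triangular G" by (auto simp: G_def mat_diag_def)
    hence "Determinant.det G = prod_list (diag_mat G)" using G by (rule Determinant.det_upper_triangular)
    also have "\<dots> = (\<Prod>i<m. poly g (a i))" using G
      by (simp add: prod_list_diag_prod atLeast0LessThan G_def mat_diag_def)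
    finally show ?thesis using Determinant.det_mult[OF V G] by simp
  qed
  \<comment> \<open>\<open>det V\<close> now stands on both sides of the determinant identity and
    can be cancelled.\<close>
  moreover have "Determinant.det V \<noteq> 0" unfolding V_def by (rule det_Vandermonde_nonzero[OF inj])
  ultimately show ?thesis by simp
qed


text \<open>The degree of \<open>map_poly h g\<close> may be smaller than that of \<open>g\<close>, so \<open>h\<close> need not commute with
  the resultant in general; it does here because \<open>f\<close> is monic.\<close>

lemma hom_resultant_split_monic:
  fixes h :: "'a::comm_ring_1 \<Rightarrow> 'b::field"
  assumes hom: "comm_ring_hom h" and monic: "lead_coeff f = 1"
    and inj: "inj_on a {..<degree f}"
    and roots: "\<And>i. i < degree f \<Longrightarrow> poly (map_poly h f) (a i) = 0"
  shows "h (resultant f g) = (\<Prod>i<degree f. poly (map_poly h g) (a i))"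
proof -
  interpret comm_ring_hom h by (rule hom)
  have "h (resultant f g)
      = Determinant.det (sylvester_mat_sub (degree f) (degree g) (map_poly h f) (map_poly h g))"
    unfolding resultant_def sylvester_mat_def hom_det[symmetric]
    by (simp add: sylvester_mat_sub_map)
  also have "\<dots> = (\<Prod>i<degree f. poly (map_poly h g) (a i))"
    using monic by (intro det_Sylvester_split_monic inj roots) (auto simp: degree_map_poly_le)
  finally show ?thesis .
qed

section \<open>Evaluation of polynomials in w and the u's\<close>

definition monomial_at :: "(nat \<Rightarrow> complex) \<Rightarrow> (nat \<Rightarrow>\<^sub>0 nat) \<Rightarrow> complex" where
  "monomial_at s \<mu> = (\<Prod>i\<in>Poly_Mapping.keys \<mu>. s i ^ Poly_Mapping.lookup \<mu> i)"

text \<open>The u's take complex values because roots of unity are substituted for them; real values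
  of w suffice to identify a real polynomial.\<close>

definition wu_eval :: "(nat \<Rightarrow> complex) \<Rightarrow> real \<Rightarrow> wu_poly \<Rightarrow> complex" where
  "wu_eval s x p = (\<Sum>\<mu>\<in>Poly_Mapping.keys p.
     of_real (poly (Poly_Mapping.lookup p \<mu>) x) * monomial_at s \<mu>)"

lemma monomial_at_superset:
  assumes "finite A" "Poly_Mapping.keys \<mu> \<subseteq> A"
  shows "monomial_at s \<mu> = (\<Prod>i\<in>A. s i ^ Poly_Mapping.lookup \<mu> i)"
  unfolding monomial_at_def
  by (rule prod.mono_neutral_left) (use assms in \<open>auto simp: in_keys_iff\<close>)

lemma monomial_at_zero [simp]: "monomial_at s 0 = 1"
  by (simp add: monomial_at_def)

lemma monomial_at_add: "monomial_at s (\<mu> + \<nu>) = monomial_at s \<mu> * monomial_at s \<nu>"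
proof -
  let ?A = "Poly_Mapping.keys \<mu> \<union> Poly_Mapping.keys \<nu>"
  have "Poly_Mapping.keys (\<mu> + \<nu>) \<subseteq> ?A" by (rule Poly_Mapping.keys_add)
  thus ?thesis
    by (subst (1 2 3) monomial_at_superset[of ?A])
      (auto simp: lookup_add power_add prod.distrib)
qed

lemma wu_eval_superset:
  assumes "finite A" "Poly_Mapping.keys p \<subseteq> A"
  shows "wu_eval s x p
    = (\<Sum>\<mu>\<in>A. of_real (poly (Poly_Mapping.lookup p \<mu>) x) * monomial_at s \<mu>)"
  unfolding wu_eval_def
  by (rule sum.mono_neutral_left) (use assms in \<open>auto simp: in_keys_iff\<close>)

lemma wu_eval_zero [simp]: "wu_eval s x 0 = 0"
  by (simp add: wu_eval_def)

lemma wu_eval_single: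
  "wu_eval s x (Poly_Mapping.single \<mu> c) = of_real (poly c x) * monomial_at s \<mu>"
  by (subst wu_eval_superset[of "{\<mu>}"]) auto

lemma wu_eval_add: "wu_eval s x (p + q) = wu_eval s x p + wu_eval s x q"
proof -
  let ?A = "Poly_Mapping.keys p \<union> Poly_Mapping.keys q"
  have "Poly_Mapping.keys (p + q) \<subseteq> ?A" by (rule Poly_Mapping.keys_add)
  thus ?thesis
    by (subst (1 2 3) wu_eval_superset[of ?A])
      (auto simp: lookup_add sum.distrib distrib_right)
qed

lemma wu_eval_sum: "wu_eval s x (\<Sum>i\<in>A. p i) = (\<Sum>i\<in>A. wu_eval s x (p i))"
  by (induction A rule: infinite_finite_induct) (simp_all add: wu_eval_add)

lemma wu_poly_eq_sum_single:
  "(\<Sum>\<mu>\<in>Poly_Mapping.keys p. Poly_Mapping.single \<mu> (Poly_Mapping.lookup p \<mu>)) = p"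
  by (rule poly_mapping_eqI)
    (auto simp: lookup_sum lookup_single when_def in_keys_iff sum.delta)

lemma wu_eval_mult: "wu_eval s x (p * q) = wu_eval s x p * wu_eval s x q"
proof -
  have "p * q = (\<Sum>\<mu>\<in>Poly_Mapping.keys p. \<Sum>\<nu>\<in>Poly_Mapping.keys q.
      Poly_Mapping.single (\<mu> + \<nu>) (Poly_Mapping.lookup p \<mu> * Poly_Mapping.lookup q \<nu>))"
    by (subst (1 2) wu_poly_eq_sum_single[symmetric]) (simp add: sum_product mult_single)
  thus ?thesis
    by (simp add: wu_eval_sum wu_eval_single monomial_at_add)
      (simp add: wu_eval_def sum_product mult_ac)
qed

lemma wu_eval_one: "wu_eval s x 1 = 1"
  using wu_eval_single[of s x 0 1] by simp

lemma wu_eval_hom: "comm_ring_hom (wu_eval s x)"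
proof
  fix p q :: wu_poly
  show "wu_eval s x (p + q) = wu_eval s x p + wu_eval s x q" by (rule wu_eval_add)
  show "wu_eval s x (p * q) = wu_eval s x p * wu_eval s x q" by (rule wu_eval_mult)
qed (simp_all add: wu_eval_one)

interpretation wu_eval: comm_ring_hom "wu_eval s x" for s x
  by (rule wu_eval_hom)

lemma wu_eval_var_u [simp]: "wu_eval s x (var_u k) = s k"
  by (simp add: var_u_def wu_eval_single monomial_at_def)

lemma wu_eval_const_w [simp]: "wu_eval s x (const_w p) = of_real (poly p x)"
  by (simp add: const_w_def wu_eval_single)

text \<open>Since the coefficients of \<open>as_poly_in k g\<close> do not involve \<open>u\<^sub>k\<close>, evaluating them ignores
  the value assigned to \<open>u\<^sub>k\<close>.\<close>

lemma poly_map_wu_eval_as_poly_in: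
  "poly (map_poly (wu_eval s x) (as_poly_in k g)) a = wu_eval (s(k := a)) x g"
proof -
  have mon: "monomial_at (s(k := a)) \<mu> = monomial_at s \<mu>"
    if "Poly_Mapping.lookup \<mu> k = 0" for \<mu>
    unfolding monomial_at_def by (intro prod.cong) (use that in \<open>auto simp: in_keys_iff\<close>)
  have "map_poly (wu_eval s x) (as_poly_in k g) = map_poly (wu_eval (s(k := a)) x) (as_poly_in k g)"
    by (intro poly_eqI)
      (auto simp: wu_eval_def mon coeff_as_poly_in_free intro!: sum.cong)
  moreover have "poly (map_poly (wu_eval (s(k := a)) x) (as_poly_in k g))
      (wu_eval (s(k := a)) x (var_u k)) = wu_eval (s(k := a)) x g"
    by (simp only: wu_eval.poly_map_poly poly_as_poly_in)
  ultimately show ?thesis by simp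
qed

section \<open>The iterated resultant at roots of unity\<close>

lemma as_poly_in_Q_poly:
  assumes "m > 0"
  shows "as_poly_in k (Q_poly m k) = monom 1 m - 1"
proof -
  let ?\<mu> = "Poly_Mapping.single k m"
  have pow: "var_u k ^ n = Poly_Mapping.single (Poly_Mapping.single k n) 1" for n
    by (induction n) (simp_all add: var_u_def mult_single single_add[symmetric])
  have neq: "?\<mu> \<noteq> 0"
    using assms by (metis lookup_single_eq lookup_zero less_numeral_extra(3))
  have look: "Poly_Mapping.lookup (Q_poly m k) \<nu> = (1 when \<nu> = ?\<mu>) - (1 when \<nu> = 0)" for \<nu>
    by (auto simp: Q_poly_def pow lookup_minus lookup_single lookup_one when_def)
  have keys: "Poly_Mapping.keys (Q_poly m k) = {?\<mu>, 0}"
    using neq by (auto simp: in_keys_iff look when_def split: if_splits)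
  have upd: "Poly_Mapping.update k 0 ?\<mu> = 0" "Poly_Mapping.update k 0 0 = (0 :: nat \<Rightarrow>\<^sub>0 nat)"
    by (rule poly_mapping_eqI; simp add: lookup_update lookup_single when_def)+
  show ?thesis
    using neq
    by (simp add: as_poly_in_def keys look upd when_def single_uminus minus_monom[symmetric])
qed

lemma degree_monom_minus_one:
  assumes "m > 0"
  shows "degree (monom 1 m - 1 :: 'a::comm_ring_1 poly) = m"
    and "lead_coeff (monom 1 m - 1 :: 'a::comm_ring_1 poly) = 1"
proof -
  show "degree (monom 1 m - 1 :: 'a poly) = m"
  proof (rule antisym)
    show "degree (monom 1 m - 1 :: 'a poly) \<le> m"
      by (rule degree_diff_le) (auto simp: degree_monom_le)
    show "m \<le> degree (monom 1 m - 1 :: 'a poly)"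
      using assms by (intro le_degree) simp
  qed
  thus "lead_coeff (monom 1 m - 1 :: 'a poly) = 1" using assms by simp
qed

definition unit_root :: "nat \<Rightarrow> int \<Rightarrow> complex" where
  "unit_root m j = cis (2 * pi * of_int j / of_nat m)"

lemma unit_root_power: "m > 0 \<Longrightarrow> unit_root m j ^ m = 1"
proof -
  assume "m > 0"
  hence "real m * (2 * pi * of_int j / real m) = 2 * pi * of_int j" by simp
  hence "unit_root m j ^ m = cis (2 * pi * of_int j)"
    by (simp only: unit_root_def Complex.DeMoivre)
  thus ?thesis by simp
qed

lemma inj_unit_root: "inj_on (unit_root m) {0..<int m}"
proof (rule inj_onI)
  fix i j assume ij: "i \<in> {0..<int m}" "j \<in> {0..<int m}" and eq: "unit_root m i = unit_root m j"
  have m: "real m > 0" using ij by auto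
  have "cis (2 * pi * (of_int i - of_int j) / of_nat m) = unit_root m i / unit_root m j"
    by (simp add: unit_root_def cis_divide diff_divide_distrib right_diff_distrib)
  also have "\<dots> = 1" using eq by (simp add: unit_root_def)
  finally have "cos (2 * pi * (of_int i - of_int j) / of_nat m) = 1"
    by (simp add: complex_eq_iff)
  then obtain n where "2 * pi * (of_int i - of_int j) / of_nat m = of_int n * 2 * pi"
    by (auto simp: cos_one_2pi_int)
  hence "pi * real_of_int (i - j) = pi * real_of_int (n * int m)" using m
    by (simp add: field_simps)
  hence "real_of_int (i - j) = real_of_int (n * int m)" by (simp only: mult_left_cancel[OF pi_neq_zero])
  hence "i - j = n * int m" by linarith
  moreover have "\<bar>i - j\<bar> < int m" using ij by auto
  ultimately have "\<bar>n\<bar> * int m < 1 * int m" by (simp add: abs_mult)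
  hence "n = 0" by (subst (asm) mult_less_cancel_right) auto
  thus "i = j" using \<open>i - j = n * int m\<close> by simp
qed

text \<open>One elimination step, by the product formula over the roots of u^m - 1. The previous
  value \<open>s k\<close> is overwritten in every factor, as it must be once \<open>u_k\<close> has
  been eliminated.\<close>

lemma wu_eval_resultant_in_Q_poly:
  assumes "m > 0"
  shows "wu_eval s x (resultant_in k (Q_poly m k) g)
    = (\<Prod>j\<in>{0..<int m}. wu_eval (s(k := unit_root m j)) x g)"
proof -
  have Q: "as_poly_in k (Q_poly m k) = monom 1 m - 1" by (rule as_poly_in_Q_poly[OF assms])
  have map_Q: "map_poly (wu_eval s x) (monom 1 m - 1) = monom 1 m - 1"
    by (rule poly_eqI) (simp add: wu_eval.hom_minus)
  have "inj_on (\<lambda>i. unit_root m (int i)) {..<m}"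
    by (intro inj_onI, drule inj_onD[OF inj_unit_root]) auto
  hence "wu_eval s x (resultant_in k (Q_poly m k) g)
      = (\<Prod>i<m. wu_eval (s(k := unit_root m (int i))) x g)"
    unfolding resultant_in_def Q
    by (subst hom_resultant_split_monic[OF wu_eval_hom, where a = "\<lambda>i. unit_root m (int i)"])
      (simp_all add: degree_monom_minus_one[OF assms] map_Q poly_monom unit_root_power[OF assms]
        poly_map_wu_eval_as_poly_in assms)
  also have "\<dots> = (\<Prod>j\<in>{0..<int m}. wu_eval (s(k := unit_root m j)) x g)"
    by (rule prod.reindex_bij_witness[of _ nat int]) auto
  finally show ?thesis .
qed

section \<open>Which variables can occur in an iterated resultant\<close>

definition u_free :: "nat \<Rightarrow> wu_poly set" where
  "u_free k = {p. \<forall>\<mu>\<in>Poly_Mapping.keys p. Poly_Mapping.lookup \<mu> k = 0}"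

lemma u_free_single: "Poly_Mapping.lookup \<mu> k = 0 \<Longrightarrow> Poly_Mapping.single \<mu> c \<in> u_free k"
  by (simp add: u_free_def)

lemma u_free_0 [intro, simp]: "0 \<in> u_free k" and u_free_1 [intro, simp]: "1 \<in> u_free k"
  by (simp_all add: u_free_def)

lemma u_free_add: "p \<in> u_free k \<Longrightarrow> q \<in> u_free k \<Longrightarrow> p + q \<in> u_free k"
  unfolding u_free_def using Poly_Mapping.keys_add[of p q] by auto

lemma u_free_uminus: "p \<in> u_free k \<Longrightarrow> - p \<in> u_free k"
  by (auto simp: u_free_def in_keys_iff)

lemma u_free_diff: "p \<in> u_free k \<Longrightarrow> q \<in> u_free k \<Longrightarrow> p - q \<in> u_free k"
  using u_free_add[OF _ u_free_uminus, of p k q] by simp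

lemma u_free_mult: "p \<in> u_free k \<Longrightarrow> q \<in> u_free k \<Longrightarrow> p * q \<in> u_free k"
  unfolding u_free_def using Poly_Mapping.keys_mult[of p q] by (auto simp: lookup_add)

lemma u_free_sum: "(\<And>i. i \<in> A \<Longrightarrow> p i \<in> u_free k) \<Longrightarrow> (\<Sum>i\<in>A. p i) \<in> u_free k"
  by (induction A rule: infinite_finite_induct) (auto intro: u_free_add)

lemma u_free_prod: "(\<And>i. i \<in> A \<Longrightarrow> p i \<in> u_free k) \<Longrightarrow> (\<Prod>i\<in>A. p i) \<in> u_free k"
  by (induction A rule: infinite_finite_induct) (auto intro: u_free_mult)

lemma u_free_power: "p \<in> u_free k \<Longrightarrow> p ^ n \<in> u_free k"
  by (induction n) (auto intro: u_free_mult)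

lemma u_free_var_u: "j \<noteq> k \<Longrightarrow> var_u k \<in> u_free j"
  unfolding var_u_def by (intro u_free_single) (simp add: lookup_single when_def)

lemma u_free_const_w: "const_w p \<in> u_free k"
  unfolding const_w_def by (intro u_free_single) simp

text \<open>By the Leibniz formula a determinant stays in any subring containing the entries; the
  permutation signs are 1 or -1.\<close>

lemma u_free_det:
  assumes "\<And>i j. i < n \<Longrightarrow> j < n \<Longrightarrow> A $$ (i, j) \<in> u_free k" "A \<in> carrier_mat n n"
  shows "Determinant.det A \<in> u_free k"
proof -
  have signof: "signof p \<in> u_free k" for p :: "nat \<Rightarrow> nat"
    by (cases p rule: sign_cases) (auto intro: u_free_uminus)
  show ?thesis
    unfolding det_def'[OF assms(2)]
    by (intro u_free_sum u_free_mult signof u_free_prod assms(1))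
      (auto dest: permutes_in_image)
qed

lemma u_free_coeff_as_poly_in:
  assumes "j = k \<or> g \<in> u_free j"
  shows "coeff (as_poly_in k g) i \<in> u_free j"
  unfolding as_poly_in_def coeff_sum coeff_monom
  using assms by (intro u_free_sum) (auto intro!: u_free_single simp: lookup_update u_free_def)

lemma u_free_resultant_in:
  assumes "j = k \<or> f \<in> u_free j" "j = k \<or> g \<in> u_free j"
  shows "resultant_in k f g \<in> u_free j"
  unfolding resultant_in_def resultant_def
proof (rule u_free_det[OF _ sylvester_carrier_mat])
  fix a b
  assume "a < degree (as_poly_in k f) + degree (as_poly_in k g)"
    "b < degree (as_poly_in k f) + degree (as_poly_in k g)"
  thus "sylvester_mat (as_poly_in k f) (as_poly_in k g) $$ (a, b) \<in> u_free j"
    using assms by (auto simp: sylvester_index_mat intro: u_free_coeff_as_poly_in)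
qed

text \<open>A variable disappears when its own resultant is taken, and the remaining resultants
  cannot bring it back, since each \<open>Q_poly\<close> involves only the variable being
  eliminated.\<close>

lemma u_free_iterated_resultant:
  "j \<in> {1..n} \<or> g \<in> u_free j \<Longrightarrow> iterated_resultant m n g \<in> u_free j"
proof (induction n arbitrary: g)
  case (Suc n)
  have "j \<in> {1..n} \<or> resultant_in (Suc n) (Q_poly m (Suc n)) g \<in> u_free j"
    using Suc.prems
    by (auto simp: Q_poly_def le_Suc_eq
        intro!: u_free_resultant_in u_free_diff u_free_power u_free_var_u)
  thus ?case using Suc.IH by simp
qed simp

lemma u_free_W_poly: "j \<notin> {1..N - 1} \<Longrightarrow> W_poly N \<in> u_free j"
  unfolding W_poly_def Vandermonde_def
  by (intro u_free_diff u_free_mult u_free_const_w u_free_prod u_free_power u_free_uminus u_free_1)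
    (auto intro!: u_free_var_u)

lemma u_free_all_imp_const_w:
  assumes "\<And>k. p \<in> u_free k"
  shows "p = const_w (Poly_Mapping.lookup p 0)"
proof -
  have "\<mu> = 0" if "\<mu> \<in> Poly_Mapping.keys p" for \<mu>
    using assms that by (intro poly_mapping_eqI) (auto simp: u_free_def)
  thus ?thesis
    unfolding const_w_def
    by (intro poly_mapping_eqI) (auto simp: lookup_single when_def in_keys_iff)
qed

section \<open>Specialization at tuples of roots of unity\<close>

definition tuples :: "nat \<Rightarrow> nat \<Rightarrow> int list set" where
  "tuples m n = {xs. set xs \<subseteq> {0..<int m} \<and> length xs = n}"

lemma finite_tuples: "finite (tuples m n)" and card_tuples: "card (tuples m n) = m ^ n"
  unfolding tuples_def by (simp_all add: finite_lists_length_eq card_lists_length_eq)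

lemma tuples_0: "tuples m 0 = {[]}"
  by (auto simp: tuples_def)

text \<open>The last entry is split off, not the first, because the resultant in the variable of
  highest index is the innermost one.\<close>

lemma prod_tuples_Suc:
  "(\<Prod>xs\<in>tuples m (Suc n). F xs) = (\<Prod>xs\<in>tuples m n. \<Prod>j\<in>{0..<int m}. F (xs @ [j]))"
proof -
  have "(\<Prod>xs\<in>tuples m (Suc n). F xs) = (\<Prod>(xs, j)\<in>tuples m n \<times> {0..<int m}. F (xs @ [j]))"
  proof (rule prod.reindex_bij_witness[of _ "\<lambda>(xs, j). xs @ [j]" "\<lambda>xs. (butlast xs, last xs)"])
    fix xs assume "xs \<in> tuples m (Suc n)"
    then obtain ys y where "xs = ys @ [y]" "ys \<in> tuples m n" "y \<in> {0..<int m}"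
      by (cases xs rule: rev_cases) (auto simp: tuples_def)
    thus "(case (butlast xs, last xs) of (xs, j) \<Rightarrow> xs @ [j]) = xs"
      "(butlast xs, last xs) \<in> tuples m n \<times> {0..<int m}"
      "(case (butlast xs, last xs) of (xs, j) \<Rightarrow> F (xs @ [j])) = F xs"
      by auto
  qed (auto simp: tuples_def)
  thus ?thesis by (simp add: prod.cartesian_product)
qed

text \<open>The index shift arises because lists start at 0 while the variables start at u_1.
  Outside the list the assignment falls back on \<open>s\<close>, so that it can be extended one
  variable at a time.\<close>

definition root_assign :: "nat \<Rightarrow> (nat \<Rightarrow> complex) \<Rightarrow> int list \<Rightarrow> nat \<Rightarrow> complex" where
  "root_assign m s xs i = (if i \<in> {1..length xs} then unit_root m (xs ! (i - 1)) else s i)"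

lemma root_assign_snoc:
  "root_assign m s (xs @ [j]) = (root_assign m s xs)(Suc (length xs) := unit_root m j)"
  by (auto simp: root_assign_def fun_eq_iff nth_append)

lemma wu_eval_iterated_resultant:
  assumes "m > 0"
  shows "wu_eval s x (iterated_resultant m n g)
    = (\<Prod>xs\<in>tuples m n. wu_eval (root_assign m s xs) x g)"
proof (induction n arbitrary: g)
  case 0
  have "root_assign m s [] = s" by (auto simp: root_assign_def fun_eq_iff)
  thus ?case by (simp add: tuples_0)
next
  case (Suc n)
  have "wu_eval s x (iterated_resultant m (Suc n) g) = (\<Prod>xs\<in>tuples m n. \<Prod>j\<in>{0..<int m}.
      wu_eval ((root_assign m s xs)(Suc n := unit_root m j)) x g)"
    by (simp add: Suc.IH wu_eval_resultant_in_Q_poly[OF assms])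
  also have "\<dots> = (\<Prod>xs\<in>tuples m n. \<Prod>j\<in>{0..<int m}. wu_eval (root_assign m s (xs @ [j])) x g)"
    by (intro prod.cong) (auto simp: root_assign_snoc tuples_def)
  finally show ?case by (simp add: prod_tuples_Suc)
qed

section \<open>The value of W_N at roots of unity\<close>

lemma unit_root_diff_power2:
  assumes "m > 0"
  shows "(unit_root m i - unit_root m j)\<^sup>2
    = - (unit_root m i * unit_root m j) * of_real (4 * (sin (pi * real_of_int (j - i) / real m))\<^sup>2)"
proof -
  \<comment> \<open>Halving the angles gives square roots p, q of the two roots of unity. Then p^2 -
    q^2 = - p q (q/p - p/q), and q/p - p/q = 2 i sin t.\<close>
  define p q where "p = cis (pi * of_int i / of_nat m)" and "q = cis (pi * of_int j / of_nat m)"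
  define t where "t = pi * real_of_int (j - i) / real m"
  have sq: "unit_root m i = p * p" "unit_root m j = q * q"
    by (simp_all add: p_def q_def unit_root_def cis_mult add_divide_distrib[symmetric] mult.assoc)
  have nz: "p \<noteq> 0" "q \<noteq> 0" by (simp_all add: p_def q_def)
  have "2 * \<i> * of_real (sin t) = cis t - cis (- t)"
    by (simp add: complex_eq_iff)
  also have "\<dots> = q / p - p / q"
    by (simp add: p_def q_def t_def cis_divide diff_divide_distrib right_diff_distrib)
  finally have "(2 * \<i> * of_real (sin t))\<^sup>2 = (q / p - p / q)\<^sup>2" by simp
  hence "- of_real (4 * (sin t)\<^sup>2) = (q / p - p / q)\<^sup>2"
    by (simp add: power_mult_distrib)
  moreover have "(p * p - q * q)\<^sup>2 = p * p * (q * q) * (q / p - p / q)\<^sup>2"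
    using nz by (simp add: field_simps power2_eq_square)
  ultimately show ?thesis
    unfolding sq t_def[symmetric] by (metis mult_minus_left mult_minus_right)
qed

text \<open>Each index lies in exactly n - 1 of the pairs; this accounts for the exponent N - 1 on
  the u's in \<open>W_poly\<close>.\<close>

lemma prod_pairs_mult:
  fixes u :: "nat \<Rightarrow> 'a::comm_monoid_mult"
  shows "(\<Prod>b<n. \<Prod>a<b. u a * u b) = (\<Prod>a<n. u a ^ (n - 1))"
proof (induction n)
  case (Suc n)
  have "(\<Prod>a<n. u a ^ n) = (\<Prod>a<n. u a ^ (n - 1)) * (\<Prod>a<n. u a)"
    unfolding prod.distrib[symmetric]
    by (intro prod.cong refl) (auto simp: power_Suc2[symmetric] simp del: power_Suc)
  thus ?case using Suc.IH by (simp add: prod.distrib mult_ac)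
qed simp

lemma prod_pairs_const: "(\<Prod>b<n. \<Prod>a<b. c) = c ^ (n choose 2)"
  for c :: "'a::comm_monoid_mult"
  by (induction n) (simp_all add: numeral_2_eq_2 power_add mult_ac)

text \<open>Each pair contributes a factor -1 to the squared Vandermonde product, which the sign in
  \<open>W_poly\<close> compensates, and the factors u_a u_b multiply to the very monomial that
  accompanies w. Hence this monomial can be pulled out of both terms.\<close>

lemma wu_eval_W_poly:
  assumes "m > 0" "N \<ge> 1" "length xs = N - 1"
  shows "wu_eval (root_assign m s xs) x (W_poly N)
    = (\<Prod>i<N - 1. unit_root m (xs ! i)) ^ (N - 1) * of_real (x - rval N m xs)"
proof -
  define u where "u i = unit_root m ((0 # xs) ! i)" for i
  have u0: "u 0 = 1" by (simp add: u_def unit_root_def)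
  have ra: "root_assign m s xs a = u a" if "a \<in> {1..N - 1}" for a
    using that assms by (auto simp: root_assign_def u_def nth_Cons')
  have prod_u: "(\<Prod>a<N. u a ^ (N - 1)) = (\<Prod>a\<in>{1..N - 1}. u a ^ (N - 1))"
  proof -
    have "{..<N} = insert 0 {1..N - 1}" using assms(2) by auto
    thus ?thesis by (simp add: u0)
  qed
  have "(\<Prod>b<N. \<Prod>a<b. u a - u b)\<^sup>2 = (\<Prod>b<N. \<Prod>a<b. (u a - u b)\<^sup>2)"
    by (simp add: prod_power_distrib)
  also have "\<dots> = (\<Prod>b<N. \<Prod>a<b. (- 1) * (u a * u b) * of_real (4 * (sin_diff m xs a b)\<^sup>2))"
    unfolding u_def sin_diff_def by (intro prod.cong refl) (subst unit_root_diff_power2[OF assms(1)], simp)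
  also have "\<dots> = (- 1) ^ (N choose 2) * (\<Prod>a<N. u a ^ (N - 1)) * of_real (rval N m xs)"
    unfolding prod.distrib prod_pairs_mult[symmetric] prod_pairs_const[symmetric]
    by (simp add: rval_def)
  finally have disc: "(\<Prod>b<N. \<Prod>a<b. u a - u b)\<^sup>2
    = (- 1) ^ (N choose 2) * (\<Prod>a\<in>{1..N - 1}. u a ^ (N - 1)) * of_real (rval N m xs)"
    unfolding prod_u .
  have vdm: "wu_eval (root_assign m s xs) x (Vandermonde N (\<lambda>a. if a = 0 then 1 else var_u a))
      = (\<Prod>b<N. \<Prod>a<b. u a - u b)"
    unfolding Vandermonde_def wu_eval.hom_prod
  proof (intro prod.cong refl)
    fix b a assume "b \<in> {..<N}" "a \<in> {..<b}"
    thus "wu_eval (root_assign m s xs) x ((if a = 0 then 1 else var_u a) - (if b = 0 then 1 else var_u b))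
      = u a - u b"
      using ra[of a] ra[of b] by (auto simp: wu_eval.hom_minus u0)
  qed
  have "wu_eval (root_assign m s xs) x (W_poly N)
    = of_real x * (\<Prod>a\<in>{1..N - 1}. u a ^ (N - 1))
      - (- 1) ^ (N choose 2) * (\<Prod>b<N. \<Prod>a<b. u a - u b)\<^sup>2"
    unfolding W_poly_def
    by (simp add: wu_eval.hom_minus wu_eval.hom_mult wu_eval.hom_power wu_eval.hom_prod
        wu_eval.hom_uminus vdm ra)
  also have "\<dots> = (\<Prod>a\<in>{1..N - 1}. u a ^ (N - 1)) * of_real (x - rval N m xs)"
    unfolding disc by (simp add: algebra_simps power_mult_distrib[symmetric] flip: mult.assoc)
  also have "(\<Prod>a\<in>{1..N - 1}. u a ^ (N - 1)) = (\<Prod>i<N - 1. unit_root m (xs ! i)) ^ (N - 1)"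
    unfolding prod_power_distrib[symmetric]
    by (rule arg_cong[of _ _ "\<lambda>t. t ^ (N - 1)"], rule prod.reindex_bij_witness[of _ Suc "\<lambda>i. i - 1"])
      (auto simp: u_def nth_Cons')
  finally show ?thesis .
qed

section \<open>Tuples and the alcove\<close>

text \<open>Passing from pairs a < b to all ordered pairs of distinct indices removes the dependence
  on the order of the list.\<close>

lemma prod_pairs_symmetrize:
  fixes h :: "nat \<Rightarrow> nat \<Rightarrow> 'a::comm_monoid_mult"
  shows "(\<Prod>b<n. \<Prod>a<b. h a b * h b a) = (\<Prod>b<n. \<Prod>a\<in>{..<n} - {b}. h a b)"
proof (induction n)
  case (Suc n)
  have "(\<Prod>b<n. \<Prod>a\<in>{..<Suc n} - {b}. h a b) = (\<Prod>b<n. h n b * (\<Prod>a\<in>{..<n} - {b}. h a b))"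
  proof (intro prod.cong refl)
    fix b assume "b \<in> {..<n}"
    hence "{..<Suc n} - {b} = insert n ({..<n} - {b})" by auto
    thus "(\<Prod>a\<in>{..<Suc n} - {b}. h a b) = h n b * (\<Prod>a\<in>{..<n} - {b}. h a b)" by simp
  qed
  moreover have "{..<Suc n} - {n} = {..<n}" by auto
  moreover have "(\<Prod>b<Suc n. \<Prod>a<b. h a b * h b a)
      = (\<Prod>b<n. \<Prod>a\<in>{..<n} - {b}. h a b) * (\<Prod>a<n. h a n * h n a)"
    by (simp add: Suc.IH)
  ultimately show ?case by (simp add: prod.distrib mult_ac)
qed simp

text \<open>Each 4 sin^2 is shared as one factor |2 sin| for either order of the pair. The
  right-hand side depends only on the set of entries, so \<open>rval\<close> is invariant under
  permutations.\<close>

lemma rval_eq_prod_set: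
  assumes "distinct (0 # xs)" "length xs = N - 1" "N \<ge> 1"
  shows "rval N m xs = (\<Prod>q\<in>insert 0 (set xs). \<Prod>p\<in>insert 0 (set xs) - {q}.
    \<bar>2 * sin (pi * real_of_int (q - p) / real m)\<bar>)"
proof -
  let ?l = "0 # xs"
  let ?S = "insert 0 (set xs)"
  define g where "g p q = \<bar>2 * sin (pi * real_of_int (q - p) / real m)\<bar>" for p q
  have g_sym: "g p q = g q p" for p q
  proof -
    have "pi * real_of_int (p - q) / real m = - (pi * real_of_int (q - p) / real m)"
      by (simp add: right_diff_distrib diff_divide_distrib)
    thus ?thesis unfolding g_def by (simp only: sin_minus mult_minus_right abs_minus_cancel)
  qed
  have len: "length ?l = N" using assms by simp
  have bij: "bij_betw ((!) ?l) {..<N} ?S"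
    using bij_betw_nth[OF assms(1) refl, of ?S] len by simp
  have "rval N m xs = (\<Prod>b<N. \<Prod>a<b. g (?l ! a) (?l ! b) * g (?l ! b) (?l ! a))"
    unfolding rval_def
    by (subst (2) g_sym) (simp add: g_def sin_diff_def power2_eq_square flip: abs_mult)
  also have "\<dots> = (\<Prod>b<N. \<Prod>a\<in>{..<N} - {b}. g (?l ! a) (?l ! b))"
    by (rule prod_pairs_symmetrize)
  also have "\<dots> = (\<Prod>b<N. \<Prod>p\<in>?S - {?l ! b}. g p (?l ! b))"
  proof (intro prod.cong refl)
    fix b assume b: "b \<in> {..<N}"
    have "bij_betw ((!) ?l) ({..<N} - {b}) (?S - {?l ! b})"
      by (rule bij_betw_DiffI[OF bij])
        (use b bij_betw_apply[OF bij b] in \<open>auto simp: bij_betw_def\<close>)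
    thus "(\<Prod>a\<in>{..<N} - {b}. g (?l ! a) (?l ! b)) = (\<Prod>p\<in>?S - {?l ! b}. g p (?l ! b))"
      by (rule prod.reindex_bij_betw)
  qed
  also have "\<dots> = (\<Prod>q\<in>?S. \<Prod>p\<in>?S - {q}. g p q)"
    by (rule prod.reindex_bij_betw[OF bij])
  finally show ?thesis by (simp add: g_def)
qed

lemma rval_eq_0:
  assumes "\<not> distinct (0 # xs)" "length xs = N - 1" "N \<ge> 1"
  shows "rval N m xs = 0"
proof -
  have len: "length (0 # xs) = N" using assms by simp
  obtain a b where "a < N" "b < N" "a \<noteq> b" "(0 # xs) ! a = (0 # xs) ! b"
    using assms(1) unfolding distinct_conv_nth len by blast
  then obtain a b where ab: "a < b" "b < N" and eq: "(0 # xs) ! a = (0 # xs) ! b"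
    by (metis linorder_neqE_nat)
  have "sin_diff m xs a b = 0" unfolding sin_diff_def eq by simp
  hence "(\<Prod>a<b. 4 * (sin_diff m xs a b)\<^sup>2) = 0"
    using ab by (intro prod_zero bexI[of _ a]) auto
  hence "\<exists>b\<in>{..<N}. (\<Prod>a<b. 4 * (sin_diff m xs a b)\<^sup>2) = 0" using ab(2) by blast
  thus ?thesis unfolding rval_def by (intro prod_zero) simp_all
qed

lemma alcove_iff:
  "xs \<in> alcove N m \<longleftrightarrow> length xs = N - 1 \<and> sorted_wrt (<) xs \<and> set xs \<subseteq> {1..<int m}"
  by (auto simp: alcove_def)

text \<open>Sorting inverts \<open>set\<close> here. The bijection gives the binomial count, and its
  injectivity keeps the permutation classes of different alcove points disjoint.\<close>

lemma bij_betw_set_alcove: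
  "bij_betw set (alcove N m) {S. S \<subseteq> {1..<int m} \<and> card S = N - 1}"
proof (rule bij_betw_byWitness[where f' = sorted_list_of_set])
  show "\<forall>xs\<in>alcove N m. sorted_list_of_set (set xs) = xs"
    by (auto simp: alcove_iff strict_sorted_equal)
  show "\<forall>S\<in>{S. S \<subseteq> {1..<int m} \<and> card S = N - 1}. set (sorted_list_of_set S) = S"
    by (auto dest: finite_subset)
  show "set ` alcove N m \<subseteq> {S. S \<subseteq> {1..<int m} \<and> card S = N - 1}"
    by (simp add: image_subset_iff alcove_iff strict_sorted_iff distinct_card)
  show "sorted_list_of_set ` {S. S \<subseteq> {1..<int m} \<and> card S = N - 1} \<subseteq> alcove N m"
    using finite_subset[OF _ finite_atLeastLessThan_int] by (auto simp: alcove_iff)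
qed

lemma finite_alcove [simp]: "finite (alcove N m)"
  using bij_betw_finite[OF bij_betw_set_alcove[of N m]] by simp

lemma card_alcove: "m > 0 \<Longrightarrow> card (alcove N m) = alcove_count N m"
  using bij_betw_same_card[OF bij_betw_set_alcove[of N m]]
    n_subsets[of "{1..<int m}" "N - 1"]
  by (simp add: alcove_count_def nat_diff_distrib)

lemma distinct_tuples_eq:
  "{xs \<in> tuples m (N - 1). distinct (0 # xs)} = (\<Union>ys\<in>alcove N m. permutations_of_set (set ys))"
proof (intro equalityI subsetI)
  fix xs assume "xs \<in> {xs \<in> tuples m (N - 1). distinct (0 # xs)}"
  hence xs: "set xs \<subseteq> {0..<int m}" "0 \<notin> set xs" "length xs = N - 1" "distinct xs"
    by (auto simp: tuples_def)
  have "set xs \<subseteq> {1..<int m}"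
  proof
    fix x assume "x \<in> set xs"
    hence "x \<in> {0..<int m}" "x \<noteq> 0" using xs by auto
    thus "x \<in> {1..<int m}" by auto
  qed
  with xs have "set xs \<in> set ` alcove N m"
    using bij_betw_set_alcove[of N m] by (auto simp: bij_betw_def distinct_card)
  thus "xs \<in> (\<Union>ys\<in>alcove N m. permutations_of_set (set ys))"
    using xs by (auto simp: permutations_of_set_def)
next
  fix xs assume "xs \<in> (\<Union>ys\<in>alcove N m. permutations_of_set (set ys))"
  then obtain ys where ys: "ys \<in> alcove N m" "set xs = set ys" "distinct xs"
    by (auto simp: permutations_of_set_def)
  hence "length xs = N - 1"
    by (metis alcove_iff distinct_card strict_sorted_iff)
  thus "xs \<in> {xs \<in> tuples m (N - 1). distinct (0 # xs)}"
    using ys by (force simp: tuples_def alcove_iff)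
qed

lemma disjoint_permutations_alcove:
  "\<forall>ys\<in>alcove N m. \<forall>zs\<in>alcove N m. ys \<noteq> zs \<longrightarrow>
     permutations_of_set (set ys) \<inter> permutations_of_set (set zs) = {}"
  using bij_betw_imp_inj_on[OF bij_betw_set_alcove[of N m]]
  by (auto simp: permutations_of_set_def inj_on_def)

lemma card_permutations_alcove:
  "ys \<in> alcove N m \<Longrightarrow> card (permutations_of_set (set ys)) = fact (N - 1)"
  by (simp add: alcove_iff strict_sorted_iff distinct_card)

lemma prod_tuples_rval:
  assumes "N \<ge> 1" "m > 0"
  shows "(\<Prod>xs\<in>tuples m (N - 1). x - rval N m xs)
    = x ^ (m ^ (N - 1) - alcove_count N m * fact (N - 1)) * poly (D_poly N m) x ^ fact (N - 1)"
proof -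
  let ?T = "tuples m (N - 1)"
  let ?G = "{xs \<in> ?T. distinct (0 # xs)}"
  have "card ?G = (\<Sum>ys\<in>alcove N m. card (permutations_of_set (set ys)))"
    unfolding distinct_tuples_eq using disjoint_permutations_alcove by (intro card_UN_disjoint) auto
  hence card_G: "card ?G = alcove_count N m * fact (N - 1)"
    by (simp add: card_permutations_alcove card_alcove[OF assms(2)] del: card_permutations_of_set)
  \<comment> \<open>The factors outside \<open>?G\<close> are all equal to \<open>x\<close>;
    counting them gives the exponent in \<open>f_poly\<close>.\<close>
  have "(\<Prod>xs\<in>?T - ?G. x - rval N m xs) = (\<Prod>xs\<in>?T - ?G. x)"
    by (intro prod.cong refl) (use assms in \<open>auto simp: tuples_def rval_eq_0\<close>)
  also have "\<dots> = x ^ (m ^ (N - 1) - alcove_count N m * fact (N - 1))"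
    using finite_tuples[of m "N - 1"] card_G
    by (simp add: card_Diff_subset card_tuples)
  finally have bad: "(\<Prod>xs\<in>?T - ?G. x - rval N m xs) = \<dots>" .
  have rval_perm: "rval N m xs = rval N m ys"
    if "ys \<in> alcove N m" "xs \<in> permutations_of_set (set ys)" for xs ys
  proof -
    have *: "set xs = set ys" "distinct (0 # xs)" "distinct (0 # ys)" "length ys = N - 1"
      using that by (auto simp: alcove_iff permutations_of_set_def strict_sorted_iff)
    moreover have "length xs = N - 1" using * distinct_card[of xs] distinct_card[of ys] by simp
    ultimately show ?thesis using assms(1) by (simp add: rval_eq_prod_set)
  qed
  have "(\<Prod>xs\<in>?G. x - rval N m xs)
      = (\<Prod>ys\<in>alcove N m. \<Prod>xs\<in>permutations_of_set (set ys). x - rval N m xs)"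
    unfolding distinct_tuples_eq
    using disjoint_permutations_alcove by (intro prod.UNION_disjoint) auto
  also have "\<dots> = (\<Prod>ys\<in>alcove N m. (x - rval N m ys) ^ fact (N - 1))"
    by (intro prod.cong refl) (simp add: rval_perm card_permutations_alcove cong: prod.cong del: card_permutations_of_set)
  also have "\<dots> = poly (D_poly N m) x ^ fact (N - 1)"
    by (simp add: D_poly_def poly_prod prod_power_distrib)
  finally show ?thesis
    using bad prod.subset_diff[of ?G ?T "\<lambda>xs. x - rval N m xs"] finite_tuples[of m "N - 1"] by simp
qed

section \<open>The sign eps\<close>

lemma prod_cis_arith: "(\<Prod>j<n. cis (2 * t * real j)) = cis (t * (real n * (real n - 1)))"
  by (induction n) (simp_all add: cis_mult algebra_simps)

lemma prod_unit_root:
  assumes "m > 0"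
  shows "(\<Prod>j\<in>{0..<int m}. unit_root m j) = (- 1) ^ (m - 1)"
proof -
  have "(\<Prod>j\<in>{0..<int m}. unit_root m j) = (\<Prod>j<m. cis (2 * (pi / real m) * real j))"
    by (rule prod.reindex_bij_witness[of _ int nat]) (auto simp: unit_root_def)
  \<comment> \<open>With t = pi / m and n = m the total angle t n (n - 1) equals (m - 1) pi.\<close>
  also have "\<dots> = cis (real (m - 1) * pi)"
    unfolding prod_cis_arith using assms by (simp add: of_nat_diff mult.commute)
  also have "\<dots> = (- 1) ^ (m - 1)" by (simp add: Complex.DeMoivre[symmetric])
  finally show ?thesis .
qed

text \<open>In the recursion \<open>P_Suc\<close> every value of the new coordinate meets all m^n
  shorter tuples. For odd m the sign E is 1 throughout. For even m both exponents m and m^n are even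
  once n >= 1, so \<open>P (Suc n)\<close> is 1; at n = 0 the exponent m^0 = 1 lets E survive, which
  is the exceptional case N = 2.\<close>

lemma prod_tuples_unit_root:
  assumes "m > 0" "N \<ge> 2"
  shows "(\<Prod>xs\<in>tuples m (N - 1). (\<Prod>i<N - 1. unit_root m (xs ! i)) ^ (N - 1)) = of_real (eps N m)"
proof -
  define E :: complex where "E = (- 1) ^ (m - 1)"
  define P where "P n = (\<Prod>xs\<in>tuples m n. \<Prod>i<n. unit_root m (xs ! i))" for n
  have P_0: "P 0 = 1" by (simp add: P_def tuples_0)
  have P_Suc: "P (Suc n) = P n ^ m * E ^ (m ^ n)" for n
  proof -
    have "P (Suc n) = (\<Prod>xs\<in>tuples m n. \<Prod>j\<in>{0..<int m}.
        (\<Prod>i<n. unit_root m (xs ! i)) * unit_root m j)"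
      unfolding P_def prod_tuples_Suc
      by (intro prod.cong refl) (auto simp: tuples_def nth_append intro!: prod.cong)
    also have "\<dots> = P n ^ m * E ^ (m ^ n)"
      by (simp add: prod.distrib prod_unit_root[OF assms(1)] P_def E_def prod_power_distrib card_tuples)
    finally show ?thesis .
  qed
  have E2: "E ^ 2 = 1" by (simp add: E_def power_mult[symmetric])
  have P2: "P n ^ 2 = 1" for n
  proof (induction n)
    case (Suc n)
    have "P (Suc n) ^ 2 = (P n ^ 2) ^ m * (E ^ 2) ^ (m ^ n)"
      by (simp add: P_Suc power_mult_distrib power_mult[symmetric] mult.commute)
    thus ?case using Suc E2 by simp
  qed (simp add: P_0)
  have "P (N - 1) ^ (N - 1) = of_real (eps N m)"
  proof (cases "N = 2")
    case True
    thus ?thesis using P_Suc[of 0] by (simp add: P_0 eps_def E_def)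
  next
    case False
    then obtain n where N: "N - 1 = Suc (Suc n)"
      using assms(2) that[of "N - 3"] by linarith
    have "P (Suc (Suc n)) = 1"
    proof (cases "even m")
      case True
      hence "even (m ^ Suc n)" by simp
      then obtain k l where "m = 2 * k" "m ^ Suc n = 2 * l" using True by (metis evenE)
      thus ?thesis unfolding P_Suc[of "Suc n"] using P2[of "Suc n"] E2 by (metis mult_1 power_mult power_one)
    next
      case False
      hence "E = 1" by (simp add: E_def)
      hence "P k = 1" for k by (induction k) (simp_all add: P_0 P_Suc)
      thus ?thesis .
    qed
    thus ?thesis using False N by (simp add: eps_def)
  qed
  thus ?thesis by (simp add: P_def prod_power_distrib)
qed

lemma iterated_resultant_W_poly:
  assumes "N \<ge> 2" "m > 0"
  shows "iterated_resultant m (N - 1) (W_poly N)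
    = const_w (f_poly N m * D_poly N m ^ fact (N - 1))"
proof -
  let ?I = "iterated_resultant m (N - 1) (W_poly N)"
  obtain R where R: "?I = const_w R"
    \<comment> \<open>The variables u_1, ..., u_(N-1) are eliminated, and no other variable occurs
      in \<open>W_poly N\<close>.\<close>
    using u_free_all_imp_const_w[of ?I] u_free_iterated_resultant u_free_W_poly by blast
  have "poly R x = poly (f_poly N m * D_poly N m ^ fact (N - 1)) x" for x
  proof -
    \<comment> \<open>The base assignment 0 is arbitrary, because a constant in the u's has the same
      value everywhere.\<close>
    have "complex_of_real (poly R x) = wu_eval (\<lambda>_. 0) x ?I" by (simp only: R wu_eval_const_w)
    also have "\<dots> = (\<Prod>xs\<in>tuples m (N - 1).
        (\<Prod>i<N - 1. unit_root m (xs ! i)) ^ (N - 1) * of_real (x - rval N m xs))"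
      unfolding wu_eval_iterated_resultant[OF assms(2)]
      by (intro prod.cong refl wu_eval_W_poly) (use assms in \<open>auto simp: tuples_def\<close>)
    also have "\<dots> = of_real (eps N m * (\<Prod>xs\<in>tuples m (N - 1). x - rval N m xs))"
      unfolding prod.distrib prod_tuples_unit_root[OF assms(2,1)] by simp
    also have "\<dots> = of_real (poly (f_poly N m * D_poly N m ^ fact (N - 1)) x)"
      using assms by (subst prod_tuples_rval) (simp_all add: f_poly_def poly_monom)
    finally show ?thesis by (simp only: of_real_eq_iff)
  qed
  hence "R = f_poly N m * D_poly N m ^ fact (N - 1)" by (intro poly_eqI_degree poly_eq_poly_eq_iff[THEN iffD1] ext)
  with R show ?thesis by simp
qed

lemma to_fract_power: "to_fract (a ^ n) = to_fract a ^ n"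
  by (induction n) simp_all

lemma resultant_formula:
  assumes "N \<ge> 2" "m > 0"
  shows "\<exists>R :: real poly. iterated_resultant m (N - 1) (W_poly N) = const_w R \<and>
    to_fract (D_poly N m) ^ fact (N - 1) = inverse (to_fract (f_poly N m)) * to_fract R"
proof -
  have "f_poly N m \<noteq> 0" by (simp add: f_poly_def eps_def)
  thus ?thesis
    using iterated_resultant_W_poly[OF assms] by (auto simp: to_fract_power)
qed

section \<open>The generating function\<close>

text \<open>Differences of coordinates lie strictly between 0 and m, so the arguments of the sines
  lie strictly between 0 and pi. Positivity legitimizes every later division by r_x.\<close>

lemma rval_pos:
  assumes "xs \<in> alcove N m"
  shows "rval N m xs > 0"
proof -
  have "(sin_diff m xs a b)\<^sup>2 > 0" if "b < N" "a < b" for a b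
  proof -
    have *: "sorted_wrt (<) (0 # xs)" "b < length (0 # xs)"
      using assms that by (auto simp: alcove_def)
    define d where "d = (0 # xs) ! b - (0 # xs) ! a"
    have "d > 0" unfolding d_def using sorted_wrt_nth_less[OF *(1) that(2) *(2)] by simp
    have bounds: "0 \<le> (0 # xs) ! i \<and> (0 # xs) ! i < int m" if "i \<le> b" for i
    proof -
      have "(0 # xs) ! i \<in> set (0 # xs)" by (rule nth_mem) (use that * in simp)
      \<comment> \<open>Positivity of m is no hypothesis here; it comes from the entry at position b
        > 0, which is positive and below m.\<close>
      moreover have "0 < int m"
      proof -
        have "xs ! (b - 1) \<in> set xs" using *(2) \<open>a < b\<close> by (intro nth_mem) auto
        thus ?thesis using assms by (fastforce simp: alcove_def)
      qed
      ultimately show ?thesis using assms by (auto simp: alcove_def)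
    qed
    have "d < int m" using bounds[of a] bounds[of b] \<open>a < b\<close> by (simp add: d_def)
    hence "0 < pi * real_of_int d / real m" "pi * real_of_int d / real m < pi"
      using \<open>d > 0\<close> by (simp_all add: divide_less_eq)
    hence "sin (pi * real_of_int d / real m) > 0" by (rule sin_gt_zero)
    thus ?thesis by (simp add: sin_diff_def d_def)
  qed
  thus ?thesis unfolding rval_def by (intro prod_pos) auto
qed

lemma cconst_pos: "N > 0 \<Longrightarrow> m > 0 \<Longrightarrow> cconst N m > 0"
  by (simp add: cconst_def)

text \<open>The value chosen for V_0 is exactly the power sum with exponent 0, so one formula covers
  all n.\<close>

lemma verlinde_eq_sum:
  assumes "m > 0"
  shows "verlinde N m n = 2 * (\<Sum>xs\<in>alcove N m. (cconst N m / rval N m xs) ^ n)"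
proof (cases "n = 0")
  case True
  thus ?thesis using card_alcove[OF assms] by (simp add: verlinde_def)
next
  case False
  have powi: "(2 * t) powi (- 2 * int n) = inverse ((4 * t\<^sup>2) ^ n)" for t :: real
  proof -
    have "(2 * t) powi (- 2 * int n) = (2 * t) powi (- int (2 * n))" by simp
    also have "\<dots> = inverse ((2 * t) ^ (2 * n))" by (simp only: power_int_minus power_int_of_nat)
    finally show ?thesis by (simp add: power_mult power_mult_distrib)
  qed
  have "(\<Prod>b<N. \<Prod>a<b. (2 * sin_diff m xs a b) powi (- 2 * int n)) = inverse (rval N m xs ^ n)" for xs
    unfolding powi rval_def by (simp only: prod_inversef[unfolded o_def] prod_power_distrib)
  thus ?thesis using False
    by (simp add: verlinde_def verlinde_sum_def cconst_def sum_distrib_left divide_inverse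
        power_mult_distrib power_inverse mult.assoc)
qed

section \<open>The formal generating function and the recursion\<close>

lemma pderiv_prod_linear:
  fixes r :: "'a \<Rightarrow> 'b::idom"
  shows "pderiv (\<Prod>x\<in>A. [:- r x, 1:]) = (\<Sum>x\<in>A. \<Prod>y\<in>A - {x}. [:- r y, 1:])"
  by (simp add: pderiv_prod pderiv_pCons)

text \<open>Both terms are written as sums over x with the product over the other factors in common;
  their cofactors w - r_x and w differ by the constant -r_x.\<close>

lemma card_mult_prod_minus_pderiv:
  fixes r :: "'a \<Rightarrow> 'b::idom"
  assumes "finite A"
  shows "of_nat (card A) * (\<Prod>x\<in>A. [:- r x, 1:]) - [:0, 1:] * pderiv (\<Prod>x\<in>A. [:- r x, 1:])
    = (\<Sum>x\<in>A. smult (- r x) (\<Prod>y\<in>A - {x}. [:- r y, 1:]))"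
proof -
  have "of_nat (card A) * (\<Prod>x\<in>A. [:- r x, 1:]) = (\<Sum>x\<in>A. \<Prod>x\<in>A. [:- r x, 1:])" by simp
  also have "\<dots> = (\<Sum>x\<in>A. [:- r x, 1:] * (\<Prod>y\<in>A - {x}. [:- r y, 1:]))"
    by (intro sum.cong refl prod.remove assms)
  finally have "of_nat (card A) * (\<Prod>x\<in>A. [:- r x, 1:]) - [:0, 1:] * pderiv (\<Prod>x\<in>A. [:- r x, 1:])
    = (\<Sum>x\<in>A. ([:- r x, 1:] - [:0, 1:]) * (\<Prod>y\<in>A - {x}. [:- r y, 1:]))"
    unfolding pderiv_prod_linear sum_distrib_left by (simp only: sum_subtractf[symmetric] left_diff_distrib)
  thus ?thesis by simp
qed

lemma D_scaled_eq: "D_scaled N m = (\<Prod>xs\<in>alcove N m. [:- rval N m xs, cconst N m:])"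
  by (simp add: D_scaled_def D_poly_def pcompose_hom.hom_prod pcompose_pCons)

lemma P_poly_eq:
  assumes "m > 0"
  shows "P_poly N m = (\<Sum>xs\<in>alcove N m. smult (- 2 * rval N m xs)
    (\<Prod>ys\<in>alcove N m - {xs}. [:- rval N m ys, cconst N m:]))"
proof -
  let ?c = "[:0, cconst N m:]"
  have "P_poly N m = 2 * ((of_nat (card (alcove N m)) * D_poly N m
      - [:0, 1:] * pderiv (D_poly N m)) \<circ>\<^sub>p ?c)"
    by (simp add: P_poly_def D_scaled_def card_alcove[OF assms] pcompose_diff pcompose_mult
        pcompose_hom.hom_of_nat pcompose_pCons)
  also have "\<dots> = 2 * (\<Sum>xs\<in>alcove N m. smult (- rval N m xs)
    (\<Prod>ys\<in>alcove N m - {xs}. [:- rval N m ys, cconst N m:]))"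
    unfolding D_poly_def card_mult_prod_minus_pderiv[OF finite_alcove]
    by (simp add: pcompose_hom.hom_sum pcompose_smult pcompose_uminus pcompose_hom.hom_prod pcompose_pCons)
  finally show ?thesis by (simp add: sum_distrib_left numeral_poly mult.commute)
qed

lemma degree_prod_linear_le:
  fixes a b :: "'a \<Rightarrow> 'b::comm_semiring_1"
  assumes "finite A"
  shows "degree (\<Prod>x\<in>A. [:a x, b x:]) \<le> card A"
proof -
  have "degree (\<Prod>x\<in>A. [:a x, b x:]) \<le> (\<Sum>x\<in>A. degree [:a x, b x:])"
    using assms degree_prod_sum_le[of A "\<lambda>x. [:a x, b x:]"] by (simp add: o_def)
  also have "\<dots> \<le> (\<Sum>x\<in>A. 1)" by (intro sum_mono) auto
  finally show ?thesis by simp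
qed

text \<open>The generating function with denominators cleared. Comparing coefficients gives the
  recursion, and cancelling D_N(c tau) gives the closed form.\<close>

lemma verlinde_fps_mult_D_scaled:
  assumes "m > 0"
  shows "Abs_fps (verlinde N m) * fps_of_poly (D_scaled N m) = fps_of_poly (P_poly N m)"
proof -
  let ?A = "alcove N m" and ?c = "cconst N m"
  define geo where "geo xs = Abs_fps (\<lambda>n. (?c / rval N m xs) ^ n)" for xs
  \<comment> \<open>Multiplication by c tau - r telescopes the geometric series with ratio c / r,
    leaving only the constant -r.\<close>
  have geo: "geo xs * fps_of_poly [:- rval N m xs, ?c:] = fps_const (- rval N m xs)"
    if "xs \<in> ?A" for xs
  proof (rule fps_ext)
    fix n
    have "fps_of_poly [:- rval N m xs, ?c:] = fps_const (- rval N m xs) + fps_const ?c * fps_X"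
      by (simp add: fps_of_poly_pCons fps_of_poly_const)
    hence "geo xs * fps_of_poly [:- rval N m xs, ?c:]
        = fps_const (- rval N m xs) * geo xs + fps_const ?c * (fps_X * geo xs)"
      by (simp only: distrib_left mult_ac)
    thus "fps_nth (geo xs * fps_of_poly [:- rval N m xs, ?c:]) n = fps_nth (fps_const (- rval N m xs)) n"
      using rval_pos[OF that] by (cases n) (simp_all add: geo_def)
  qed
  have "Abs_fps (verlinde N m) = (\<Sum>xs\<in>?A. fps_const 2 * geo xs)"
    by (rule fps_ext)
      (simp add: verlinde_eq_sum[OF assms] fps_sum_nth geo_def sum_distrib_left)
  hence "Abs_fps (verlinde N m) * fps_of_poly (D_scaled N m)
      = (\<Sum>xs\<in>?A. fps_const 2 * geo xs * fps_of_poly (D_scaled N m))"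
    by (simp add: sum_distrib_right)
  also have "\<dots> = (\<Sum>xs\<in>?A. fps_of_poly (smult (- 2 * rval N m xs)
      (\<Prod>ys\<in>?A - {xs}. [:- rval N m ys, ?c:])))"
  proof (intro sum.cong refl)
    fix xs assume xs: "xs \<in> ?A"
    let ?R = "\<Prod>ys\<in>?A - {xs}. [:- rval N m ys, ?c:]"
    have "D_scaled N m = [:- rval N m xs, ?c:] * ?R"
      unfolding D_scaled_eq by (rule prod.remove[OF finite_alcove xs])
    hence "fps_const 2 * geo xs * fps_of_poly (D_scaled N m)
        = fps_const 2 * (geo xs * fps_of_poly [:- rval N m xs, ?c:]) * fps_of_poly ?R"
      by (simp only: fps_of_poly_mult mult.assoc)
    also have "\<dots> = fps_of_poly (smult (- 2 * rval N m xs) ?R)"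
      unfolding geo[OF xs] fps_of_poly_smult by simp
    finally show "fps_const 2 * geo xs * fps_of_poly (D_scaled N m)
      = fps_of_poly (smult (- 2 * rval N m xs) ?R)" .
  qed
  also have "\<dots> = fps_of_poly (P_poly N m)"
    unfolding P_poly_eq[OF assms] fps_of_poly_sum ..
  finally show ?thesis .
qed

lemma coeff_D_scaled_0_nonzero: "coeff (D_scaled N m) 0 \<noteq> 0"
proof -
  have "rval N m xs \<noteq> 0" if "xs \<in> alcove N m" for xs using rval_pos[OF that] by simp
  thus ?thesis by (simp add: D_scaled_eq poly_0_coeff_0[symmetric] poly_prod)
qed

text \<open>Both \<open>D_scaled\<close> and \<open>P_poly\<close> have degree at most M, so the
  truncated sum is already the full Cauchy product coefficient, and it vanishes beyond M.\<close>

lemma verlinde_recursion: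
  assumes "m > 0"
  shows "(\<Sum>k = 0..min n (alcove_count N m). coeff (D_scaled N m) k * verlinde N m (n - k))
    = (if n \<le> alcove_count N m then coeff (P_poly N m) n else 0)"
proof -
  let ?M = "alcove_count N m"
  have D: "coeff (D_scaled N m) k = 0" if "k > ?M" for k
    using degree_prod_linear_le[of "alcove N m" "\<lambda>xs. - rval N m xs" "\<lambda>_. cconst N m"] that
    by (intro coeff_eq_0) (simp add: D_scaled_eq card_alcove[OF assms])
  have "degree (P_poly N m) \<le> ?M"
    unfolding P_poly_eq[OF assms]
  proof (intro degree_sum_le finite_alcove order.trans[OF degree_smult_le])
    fix xs assume "xs \<in> alcove N m"
    have "degree (\<Prod>ys\<in>alcove N m - {xs}. [:- rval N m ys, cconst N m:]) \<le> card (alcove N m - {xs})"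
      by (rule degree_prod_linear_le) simp
    also have "\<dots> \<le> ?M" using card_mono[of "alcove N m" "alcove N m - {xs}"]
      by (simp add: card_alcove[OF assms, symmetric])
    finally show "degree (\<Prod>ys\<in>alcove N m - {xs}. [:- rval N m ys, cconst N m:]) \<le> ?M" .
  qed
  hence P: "coeff (P_poly N m) n = 0" if "n > ?M" using that by (intro coeff_eq_0) simp
  have "(\<Sum>k = 0..min n ?M. coeff (D_scaled N m) k * verlinde N m (n - k))
      = (\<Sum>k = 0..n. coeff (D_scaled N m) k * verlinde N m (n - k))"
    by (rule sum.mono_neutral_left) (auto simp: D)
  also have "\<dots> = fps_nth (fps_of_poly (D_scaled N m) * Abs_fps (verlinde N m)) n"
    by (simp add: fps_mult_nth)
  also have "\<dots> = coeff (P_poly N m) n"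
    by (simp add: mult.commute[of "fps_of_poly _"] verlinde_fps_mult_D_scaled[OF assms])
  finally show ?thesis using P by simp
qed

lemma verlinde_generating_fps:
  assumes "m > 0"
  shows "Abs_fps (verlinde N m)
    = (fps_const 2 * (fps_const (real (alcove_count N m)) - fps_X * G_fps N m))
        oo (fps_const (cconst N m) * fps_X)"
proof -
  let ?c = "fps_const (cconst N m) * fps_X" and ?p = "[:0, cconst N m:]"
  let ?D = "fps_of_poly (D_poly N m)" and ?M = "fps_const (real (alcove_count N m))"
  let ?G = "fps_const 2 * (?M - fps_X * G_fps N m)"
  have p: "fps_of_poly ?p = ?c" by (simp add: fps_of_poly_pCons fps_of_poly_const)
  have comp: "fps_of_poly (q \<circ>\<^sub>p ?p) = fps_of_poly q oo ?c" for q
    by (simp add: fps_of_poly_pcompose p)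
  have "coeff (D_poly N m) 0 \<noteq> 0"
    using coeff_D_scaled_0_nonzero[of N m] by (simp add: D_scaled_def coeff_pcompose_0 poly_0_coeff_0)
  hence "fps_nth ?D 0 \<noteq> 0" by simp
  \<comment> \<open>The quotient defining \<open>G_fps\<close> is a genuine one, because a power
    series with nonzero constant term is a unit.\<close>
  hence "G_fps N m * ?D = fps_of_poly (pderiv (D_poly N m))"
    unfolding G_fps_def by (subst fps_divide_unit) (auto simp: mult.assoc inverse_mult_eq_1)
  hence "?G * ?D = fps_const 2 * (?M * ?D - fps_X * fps_of_poly (pderiv (D_poly N m)))"
    by (simp add: left_diff_distrib mult.assoc)
  hence "(?G * ?D) oo ?c
      = (fps_const 2 * (?M * ?D - fps_X * fps_of_poly (pderiv (D_poly N m)))) oo ?c"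
    by (simp only:)
  also have "\<dots> = fps_const 2 * (?M * fps_of_poly (D_scaled N m)
      - ?c * fps_of_poly (pderiv (D_poly N m) \<circ>\<^sub>p ?p))"
    by (simp add: D_scaled_def comp fps_compose_mult_distrib fps_compose_sub_distrib)
  also have "\<dots> = fps_of_poly (P_poly N m)"
    by (simp only: P_poly_def fps_of_poly_mult fps_of_poly_diff p of_nat_poly fps_of_poly_const
        fps_of_poly_numeral numeral_fps_const)
  finally have "(?G * ?D) oo ?c = fps_of_poly (P_poly N m)" .
  moreover have "(?G * ?D) oo ?c = (?G oo ?c) * fps_of_poly (D_scaled N m)"
    by (subst fps_compose_mult_distrib) (simp_all add: D_scaled_def comp)
  ultimately have "(?G oo ?c) * fps_of_poly (D_scaled N m)
      = Abs_fps (verlinde N m) * fps_of_poly (D_scaled N m)"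
    by (simp only: verlinde_fps_mult_D_scaled[OF assms])
  moreover have "fps_of_poly (D_scaled N m) \<noteq> 0"
    using coeff_D_scaled_0_nonzero[of N m] by (metis coeff_0 fps_of_poly_nth fps_zero_nth)
  ultimately show ?thesis by simp
qed

text \<open>The sum over the alcove is grouped by the fibres of \<open>rval\<close>.\<close>

lemma verlinde_Binet:
  assumes "m > 0"
  shows "verlinde N m n = 2 * (\<Sum>a \<in> rval N m ` alcove N m.
    real (card {x \<in> alcove N m. rval N m x = a}) * (cconst N m / a) ^ n)"
  unfolding verlinde_eq_sum[OF assms]
  by (subst sum.image_gen[OF finite_alcove, of _ _ _ "rval N m"]) simp

section \<open>The analytic identity\<close>

text \<open>Both facts are read off from the complex polynomial \<open>p\<close>. Dividing the
  identity of \<open>card_mult_prod_minus_pderiv\<close> by p(z) turns each summand into -r / (z -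
  r) = 1 / (1 - z / r), the closed form of a geometric series.\<close>

lemma D_fun_eq_prod: "D_fun N m z = (\<Prod>xs\<in>alcove N m. z - of_real (rval N m xs))"
  and G_fun_eq: "(\<And>xs. xs \<in> alcove N m \<Longrightarrow> z \<noteq> of_real (rval N m xs)) \<Longrightarrow> m > 0 \<Longrightarrow>
    of_nat (alcove_count N m) - z * G_fun N m z
    = (\<Sum>xs\<in>alcove N m. 1 / (1 - z / of_real (rval N m xs)))"
proof -
  let ?A = "alcove N m"
  define r where "r xs = complex_of_real (rval N m xs)" for xs
  define p where "p = (\<Prod>xs\<in>?A. [:- r xs, 1:])"
  interpret map_poly_comm_ring_hom complex_of_real ..
  have map: "map_poly complex_of_real (D_poly N m) = p"
    by (simp add: D_poly_def p_def r_def hom_prod)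
  hence D: "D_fun N m = poly p" by (simp add: D_fun_def fun_eq_iff)
  show D_prod: "D_fun N m z = (\<Prod>xs\<in>?A. z - of_real (rval N m xs))"
    by (simp add: D p_def poly_prod r_def)
  assume z: "\<And>xs. xs \<in> ?A \<Longrightarrow> z \<noteq> of_real (rval N m xs)" and "m > 0"
  have "poly p z \<noteq> 0" using z D_prod by (simp add: D[symmetric] prod_zero_iff)
  have "of_nat (card ?A) * poly p z - z * poly (pderiv p) z
      = poly (of_nat (card ?A) * p - [:0, 1:] * pderiv p) z"
    by simp
  also have "\<dots> = (\<Sum>xs\<in>?A. - r xs * (\<Prod>ys\<in>?A - {xs}. z - r ys))"
    unfolding p_def card_mult_prod_minus_pderiv[OF finite_alcove]
    by (simp add: poly_sum poly_prod)
  also have "\<dots> = (\<Sum>xs\<in>?A. poly p z * (1 / (1 - z / r xs)))"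
  proof (intro sum.cong refl)
    fix xs assume xs: "xs \<in> ?A"
    have "poly p z = (z - r xs) * (\<Prod>ys\<in>?A - {xs}. z - r ys)"
      unfolding p_def poly_prod using prod.remove[OF finite_alcove xs, of "\<lambda>xs. z - r xs"] by simp
    moreover have "z - r xs \<noteq> 0" "r xs \<noteq> 0" using z[OF xs] rval_pos[OF xs] by (auto simp: r_def)
    moreover from this have "1 - z / r xs = - ((z - r xs) / r xs)" by (simp add: field_simps)
    ultimately show "- r xs * (\<Prod>ys\<in>?A - {xs}. z - r ys) = poly p z * (1 / (1 - z / r xs))"
      by simp
  qed
  finally have "of_nat (card ?A) * poly p z - z * poly (pderiv p) z
    = poly p z * (\<Sum>xs\<in>?A. 1 / (1 - z / r xs))"
    by (simp add: sum_distrib_left)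
  moreover have "G_fun N m z = poly (pderiv p) z / poly p z"
    by (simp add: G_fun_def D DERIV_imp_deriv[OF poly_DERIV])
  ultimately have "poly p z * (of_nat (card ?A) - z * G_fun N m z)
    = poly p z * (\<Sum>xs\<in>?A. 1 / (1 - z / r xs))"
    using \<open>poly p z \<noteq> 0\<close> by (simp add: right_diff_distrib mult.commute)
  hence "of_nat (card ?A) - z * G_fun N m z = (\<Sum>xs\<in>?A. 1 / (1 - z / r xs))"
    using \<open>poly p z \<noteq> 0\<close> by (metis mult_left_cancel)
  thus "of_nat (alcove_count N m) - z * G_fun N m z
    = (\<Sum>xs\<in>?A. 1 / (1 - z / of_real (rval N m xs)))"
    by (simp add: card_alcove[OF \<open>m > 0\<close>] r_def)
qed

text \<open>The bound on R says that R c / r_x < 1 for every x, so finitely many geometric series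
  converge together, and the zeros r_x / c of D_N(c tau) stay outside the disc.\<close>

lemma verlinde_generating_analytic:
  assumes N: "N \<ge> 1" "m \<ge> N"
    and R: "R < Min ((\<lambda>x. rval N m x / cconst N m) ` alcove N m)"
  shows "\<forall>\<tau> \<in> cball 0 R. D_fun N m (of_real (cconst N m) * \<tau>) \<noteq> 0 \<and>
      summable (\<lambda>n. norm (of_real (verlinde N m n) * \<tau> ^ n))"
    and "uniform_limit (cball 0 R)
      (\<lambda>k \<tau>. \<Sum>n<k. of_real (verlinde N m n) * \<tau> ^ n)
      (\<lambda>\<tau>. 2 * (of_nat (alcove_count N m)
         - of_real (cconst N m) * \<tau> * G_fun N m (of_real (cconst N m) * \<tau>)))
      sequentially"
proof -
  let ?A = "alcove N m" and ?c = "cconst N m"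
  define y where "y xs = ?c / rval N m xs" for xs
  have m: "m > 0" using N by simp
  have c: "?c > 0" using N by (intro cconst_pos) auto
  have y: "y xs > 0" "R * y xs < 1" if "xs \<in> ?A" for xs
  proof -
    have "R < rval N m xs / ?c" using R that by (subst (asm) Min_gr_iff) auto
    thus "y xs > 0" "R * y xs < 1"
      using c rval_pos[OF that] by (auto simp: y_def field_simps)
  qed
  have v: "verlinde N m n = 2 * (\<Sum>xs\<in>?A. y xs ^ n)" for n
    by (simp add: verlinde_eq_sum[OF m] y_def)
  \<comment> \<open>The V_n are nonnegative, so V_n R^n is a majorant on the whole disc, as the
    M-test requires.\<close>
  have bound: "norm (of_real (verlinde N m n) * \<tau> ^ n) \<le> verlinde N m n * R ^ n"
    if "\<tau> \<in> cball 0 R" for n and \<tau> :: complex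
  proof -
    have "verlinde N m n \<ge> 0" unfolding v using y by (intro mult_nonneg_nonneg sum_nonneg) (auto intro: less_imp_le)
    thus ?thesis using that by (auto simp: norm_mult norm_power intro!: mult_left_mono power_mono)
  qed
  have summable: "summable (\<lambda>n. verlinde N m n * R ^ n)" if "R \<ge> 0"
  proof -
    have "summable (\<lambda>n. 2 * (\<Sum>xs\<in>?A. (R * y xs) ^ n))"
      using y that by (intro summable_mult summable_sum summable_geometric) (auto simp: abs_mult less_imp_le)
    thus ?thesis by (simp add: v sum_distrib_left power_mult_distrib mult_ac)
  qed
  have R0: "R \<ge> 0" if "\<tau> \<in> cball 0 R" for \<tau> :: complex
    using that norm_ge_zero[of \<tau>] by (simp del: norm_ge_zero)
  have norm_lt: "norm (of_real (y xs) * \<tau>) < 1" if "\<tau> \<in> cball 0 R" "xs \<in> ?A" for \<tau> :: complex and xs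
  proof -
    have "norm (of_real (y xs) * \<tau>) \<le> y xs * R"
      using that y(1)[OF that(2)] by (simp add: norm_mult)
    thus ?thesis using y(2)[OF that(2)] by (simp add: mult.commute)
  qed
  \<comment> \<open>A zero of D_N(c tau) in the disc would give y tau = 1 for some x, against |y
    tau| < 1.\<close>
  have neq: "of_real ?c * \<tau> \<noteq> of_real (rval N m xs)" if "\<tau> \<in> cball 0 R" "xs \<in> ?A" for \<tau> :: complex and xs
  proof
    assume "of_real ?c * \<tau> = of_real (rval N m xs)"
    hence "of_real (y xs) * \<tau> = 1"
      using rval_pos[OF that(2)] by (simp add: y_def field_simps)
    thus False using norm_lt[OF that] by simp
  qed
  show "\<forall>\<tau> \<in> cball 0 R. D_fun N m (of_real ?c * \<tau>) \<noteq> 0 \<and>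
      summable (\<lambda>n. norm (of_real (verlinde N m n) * \<tau> ^ n))"
  proof (intro ballI conjI)
    fix \<tau> :: complex assume \<tau>: "\<tau> \<in> cball 0 R"
    show "D_fun N m (of_real ?c * \<tau>) \<noteq> 0"
      using neq[OF \<tau>] by (simp add: D_fun_eq_prod)
    show "summable (\<lambda>n. norm (of_real (verlinde N m n) * \<tau> ^ n))"
      by (rule summable_comparison_test'[OF summable[OF R0[OF \<tau>]]])
        (use bound[OF \<tau>] in simp)
  qed
  have limit: "suminf (\<lambda>n. of_real (verlinde N m n) * \<tau> ^ n)
      = 2 * (of_nat (alcove_count N m) - of_real ?c * \<tau> * G_fun N m (of_real ?c * \<tau>))"
    if \<tau>: "\<tau> \<in> cball 0 R" for \<tau> :: complex
  proof -
    have "(\<lambda>n. 2 * (\<Sum>xs\<in>?A. (of_real (y xs) * \<tau>) ^ n))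
        sums (2 * (\<Sum>xs\<in>?A. 1 / (1 - of_real (y xs) * \<tau>)))"
      using norm_lt[OF \<tau>] by (intro sums_mult sums_sum geometric_sums)
    moreover have "(\<Sum>xs\<in>?A. 1 / (1 - of_real (y xs) * \<tau>))
        = of_nat (alcove_count N m) - of_real ?c * \<tau> * G_fun N m (of_real ?c * \<tau>)"
      using G_fun_eq[OF neq[OF \<tau>] m] by (simp add: y_def)
    ultimately show ?thesis
      by (simp add: v sum_distrib_right power_mult_distrib mult.assoc sums_iff)
  qed
  show "uniform_limit (cball 0 R)
      (\<lambda>k \<tau>. \<Sum>n<k. of_real (verlinde N m n) * \<tau> ^ n)
      (\<lambda>\<tau>. 2 * (of_nat (alcove_count N m) - of_real ?c * \<tau> * G_fun N m (of_real ?c * \<tau>)))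
      sequentially"
  \<comment> \<open>The radius may be negative, in which case the disc is empty and the majorant
    series need not be considered.\<close>
  proof (cases "R \<ge> 0")
    case True
    have "uniform_limit (cball 0 R) (\<lambda>k \<tau>. \<Sum>n<k. complex_of_real (verlinde N m n) * \<tau> ^ n)
        (\<lambda>\<tau>. suminf (\<lambda>n. of_real (verlinde N m n) * \<tau> ^ n)) sequentially"
      using bound summable[OF True] by (rule Weierstrass_m_test)
    thus ?thesis by (rule uniform_limit_cong'[THEN iffD1, rotated -1]) (auto simp: limit)
  next
    case False
    hence "cball (0 :: complex) R = {}" by simp
    thus ?thesis by simp
  qed
qed

theorem mainTheorem1:
  fixes N m :: nat
  assumes "N \<ge> 2" and "m > N"
  shows
    \<comment> \<open>(i) the resultant formula, in the field of rational functions in w\<close>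
    "(\<exists>R :: real poly.
        iterated_resultant m (N - 1) (W_poly N) = const_w R \<and>
        to_fract (D_poly N m) ^ fact (N - 1)
          = inverse (to_fract (f_poly N m)) * to_fract R)
     \<and>
     \<comment> \<open>(ii) the generating function, formally and analytically\<close>
     Abs_fps (verlinde N m)
       = (fps_const 2 * (fps_const (real (alcove_count N m)) - fps_X * G_fps N m))
           oo (fps_const (cconst N m) * fps_X) \<and>
     (\<forall>R < Min ((\<lambda>x. rval N m x / cconst N m) ` alcove N m).
        (\<forall>\<tau> \<in> cball 0 R.
           D_fun N m (of_real (cconst N m) * \<tau>) \<noteq> 0 \<and>
           summable (\<lambda>n. norm (of_real (verlinde N m n) * \<tau> ^ n))) \<and>
        uniform_limit (cball 0 R)
          (\<lambda>k \<tau>. \<Sum>n<k. of_real (verlinde N m n) * \<tau> ^ n)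
          (\<lambda>\<tau>. 2 * (of_nat (alcove_count N m)
             - of_real (cconst N m) * \<tau> * G_fun N m (of_real (cconst N m) * \<tau>)))
          sequentially)
     \<and>
     \<comment> \<open>(iii) the linear recursion\<close>
     coeff (D_scaled N m) 0 \<noteq> 0 \<and>
     (\<forall>n. (\<Sum>k = 0..min n (alcove_count N m). coeff (D_scaled N m) k * verlinde N m (n - k))
        = (if n \<le> alcove_count N m then coeff (P_poly N m) n else 0))
     \<and>
     \<comment> \<open>(iv) the Binet formula\<close>
     (\<forall>n \<ge> 1. verlinde N m n
        = 2 * (\<Sum>a \<in> rval N m ` alcove N m.
            real (card {x \<in> alcove N m. rval N m x = a}) * (cconst N m / a) ^ n))"
proof -
  have m: "m > 0" and N: "N \<ge> 1" "m \<ge> N" using assms by simp_all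
  show ?thesis
    by (intro conjI allI impI, rule resultant_formula[OF assms(1) m],
        rule verlinde_generating_fps[OF m], erule verlinde_generating_analytic(1)[OF N],
        erule verlinde_generating_analytic(2)[OF N], rule coeff_D_scaled_0_nonzero,
        rule verlinde_recursion[OF m], rule verlinde_Binet[OF m])
qed

end
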